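(* Let $\mathbb{F}\in\{\mathbb{R},\mathbb{C}\}$, let $X$ and $Y$ be smooth normed spaces over $\mathbb{F}$, and let $[\cdot,\cdot]$ denote the unique semi-inner product compatible with the norm on each of them. Suppose that $f\colon X\to Y$ is a surjective mapping (not assumed linear or continuous) satisfying $$|[f(x),f(y)]|=|[x,y]|\quad\text{for all }x,y\in X.$$ (i) If $\dim X\ge 2$ and $\mathbb{F}=\mathbb{R}$, then $f$ is phase equivalent to a linear surjective isometry $U\colon X\to Y$. (ii) If $\dim X\ge 2$ and $\mathbb{F}=\mathbb{C}$, then $f$ is phase equivalent to a linear or conjugate linear surjective isometry $U\colon X\to Y$.
   Context: Normed spaces are over $\mathbb{F}\in\{\mathbb{R},\mathbb{C}\}$ and may be infinite-dimensional and incomplete. A support functional at $x\in X$ is a linear functional $\phi_x\in X^*$ with $\|\phi_x\|=1$ and $\phi_x(x)=\|x\|$. A normed space is smooth if at each nonzero point there is exactly one support functional. A semi-inner product on $X$ compatible with the norm is a function $[\cdot,\cdot]\colon X\times X\to\mathbb{F}$ such that $[x+y,z]=[x,z]+[y,z]$, $[\lambda x,y]=\lambda[x,y]$, $[x,\lambda y]=\overline{\lambda}[x,y]$ for all $x,y,z\in X$, $\lambda\in\mathbb{F}$; $[x,x]>0$ for $x\neq 0$; $|[x,y]|\le [x,x]^{1/2}[y,y]^{1/2}$; and $[x,x]^{1/2}=\|x\|$. If $X$ is smooth, the unique such semi-inner product is $[x,y]=\|y\|\phi_y(x)$ for $y\ne 0$ (and $[x,0]=0$). A mapping $f\colon X\to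 Y$ is phase equivalent to $U\colon X\to Y$ if there is a function $\sigma\colon X\to\mathbb{F}$ with $|\sigma(x)|=1$ and $f(x)=\sigma(x)Ux$ for all $x\in X$. Conjugate linear (anti-linear) means additive with $U(\lambda x)=\overline{\lambda}Ux$; such a $U$, or a linear $U$, is an isometry if $\|Ux\|=\|x\|$ for all $x\in X$. *)

theory Defs
  imports "HOL-Analysis.Analysis" "Jordan_Normal_Form.Conjugate"
begin

text \<open>
  A normed space over a scalar field \<open>'k\<close> (used for \<open>real\<close> and \<open>complex\<close> only) is a type of class
  \<^class>\<open>real_normed_vector\<close>, which supplies the norm and the underlying real structure, together
  with a scalar multiplication by \<open>'k\<close> that extends the real one. For \<open>'k = real\<close> the
  multiplication is necessarily \<open>scaleR\<close>. Conjugation of scalars is the overloaded constant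
  \<open>conjugate\<close>, which is the identity on \<open>real\<close> and \<open>cnj\<close> on \<open>complex\<close>.
\<close>

locale normed_space_over = vector_space smul
  for smul :: "'k::real_normed_field \<Rightarrow> 'a::real_normed_vector \<Rightarrow> 'a" +
  assumes norm_smul: "norm (smul c x) = norm c * norm x"
    and smul_of_real: "smul (of_real r) x = r *\<^sub>R x"

lemma normed_space_over_scaleR:
  "normed_space_over (scaleR :: real \<Rightarrow> 'a::real_normed_vector \<Rightarrow> 'a)"
  by unfold_locales (auto simp: algebra_simps)

text \<open>
  Being stated through a basis, the following is also correct in infinite dimension, where the
  library's natural-number valued \<open>dim\<close> may be \<open>0\<close>.
\<close>

definition dim_at_least :: "nat \<Rightarrow> ('k::field \<Rightarrow> 'a::ab_group_add \<Rightarrow> 'a) \<Rightarrow> bool" where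
  "dim_at_least n smul \<longleftrightarrow>
    (\<exists>B. \<not> module.dependent smul B \<and> module.span smul B = UNIV \<and> (infinite B \<or> n \<le> card B))"

text \<open>
  \<open>bounded_linear\<close> is the library's predicate for the underlying real spaces; together with
  linearity over \<open>'k\<close> it describes the members of the dual space. For these, \<open>onorm\<close> is the dual
  norm.
\<close>

definition support_functional ::
    "('k::real_normed_field \<Rightarrow> 'a::real_normed_vector \<Rightarrow> 'a) \<Rightarrow> 'a \<Rightarrow> ('a \<Rightarrow> 'k) \<Rightarrow> bool" where
  "support_functional smul x \<phi> \<longleftrightarrow>
    Vector_Spaces.linear smul (*) \<phi> \<and> bounded_linear \<phi> \<and> onorm \<phi> = 1 \<and> \<phi> x = of_real (norm x)"

locale smooth_normed_space = normed_space_over smul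
  for smul :: "'k::real_normed_field \<Rightarrow> 'a::real_normed_vector \<Rightarrow> 'a" +
  assumes smooth: "x \<noteq> 0 \<Longrightarrow> \<exists>!\<phi>. support_functional smul x \<phi>"

text \<open>
  Positivity says that \<open>s x x\<close> is a positive real number embedded in the scalars; hence
  \<open>norm (s x x)\<close> is \<open>s x x\<close> read as a nonnegative real, and \<open>sqrt (norm (s x x))\<close> is
  \<open>[x,x]\<close> to the power \<open>1/2\<close>.
\<close>

definition semi_inner_product ::
    "('k::{real_normed_field,conjugatable_field} \<Rightarrow> 'a::real_normed_vector \<Rightarrow> 'a)
      \<Rightarrow> ('a \<Rightarrow> 'a \<Rightarrow> 'k) \<Rightarrow> bool" where
  "semi_inner_product smul s \<longleftrightarrow>
    (\<forall>x y z. s (x + y) z = s x z + s y z) \<and>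
    (\<forall>c x y. s (smul c x) y = c * s x y) \<and>
    (\<forall>c x y. s x (smul c y) = conjugate c * s x y) \<and>
    (\<forall>x. x \<noteq> 0 \<longrightarrow> (\<exists>r>0. s x x = of_real r)) \<and>
    (\<forall>x y. norm (s x y) \<le> sqrt (norm (s x x)) * sqrt (norm (s y y))) \<and>
    (\<forall>x. sqrt (norm (s x x)) = norm x)"

definition sip ::
    "('k::{real_normed_field,conjugatable_field} \<Rightarrow> 'a::real_normed_vector \<Rightarrow> 'a)
      \<Rightarrow> 'a \<Rightarrow> 'a \<Rightarrow> 'k" where
  "sip smul = (THE s. semi_inner_product smul s)"

definition phase_equivalent ::
    "('k::real_normed_field \<Rightarrow> 'b \<Rightarrow> 'b) \<Rightarrow> ('a \<Rightarrow> 'b) \<Rightarrow> ('a \<Rightarrow> 'b) \<Rightarrow> bool" where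
  "phase_equivalent smul f U \<longleftrightarrow> (\<exists>\<sigma>. (\<forall>x. norm (\<sigma> x) = 1) \<and> (\<forall>x. f x = smul (\<sigma> x) (U x)))"

definition conjugate_linear ::
    "('k::conjugate \<Rightarrow> 'a::ab_group_add \<Rightarrow> 'a) \<Rightarrow> ('k \<Rightarrow> 'b::ab_group_add \<Rightarrow> 'b)
      \<Rightarrow> ('a \<Rightarrow> 'b) \<Rightarrow> bool" where
  "conjugate_linear scaleX scaleY U \<longleftrightarrow>
    (\<forall>x y. U (x + y) = U x + U y) \<and> (\<forall>c x. U (scaleX c x) = scaleY (conjugate c) (U x))"

definition norm_preserving :: "('a::real_normed_vector \<Rightarrow> 'b::real_normed_vector) \<Rightarrow> bool" where
  "norm_preserving U \<longleftrightarrow> (\<forall>x. norm (U x) = norm x)"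

text \<open>
  In a smooth space the definite description in \<open>sip\<close> is well-defined, and \<open>sip\<close> is given by the
  support functionals.
\<close>

lemma onorm_eq_1I:
  fixes \<phi> :: "'a::real_normed_vector \<Rightarrow> 'b::real_normed_vector"
  assumes "bounded_linear \<phi>" "\<And>x. norm (\<phi> x) \<le> norm x" "norm (\<phi> y) = norm y" "y \<noteq> 0"
  shows "onorm \<phi> = 1"
proof (rule antisym)
  show "onorm \<phi> \<le> 1"
    using assms(2) by (intro onorm_bound) simp_all
  have "norm y \<le> onorm \<phi> * norm y"
    using onorm[OF assms(1), of y] assms(3) by simp
  then show "1 \<le> onorm \<phi>"
    using assms(4) by simp
qed

context smooth_normed_space
begin

lemma linear_functional_iff:
  "Vector_Spaces.linear smul (*) \<phi> \<longleftrightarrow>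
    (\<forall>x y. \<phi> (x + y) = \<phi> x + \<phi> y) \<and> (\<forall>c x. \<phi> (smul c x) = c * \<phi> x)"
proof -
  have k: "vector_space ((*) :: 'k \<Rightarrow> 'k \<Rightarrow> 'k)"
    by unfold_locales (auto simp: algebra_simps)
  show ?thesis
    using vector_space_axioms k
    by (auto simp: Vector_Spaces.linear_def module_hom_def module_hom_axioms_def module_iff_vector_space)
qed

lemma support_functional_iff:
  assumes "y \<noteq> 0"
  shows "support_functional smul y \<phi> \<longleftrightarrow>
    (\<forall>x z. \<phi> (x + z) = \<phi> x + \<phi> z) \<and> (\<forall>c x. \<phi> (smul c x) = c * \<phi> x) \<and>
    (\<forall>x. norm (\<phi> x) \<le> norm x) \<and> \<phi> y = of_real (norm y)"
    (is "?L \<longleftrightarrow> ?R")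
proof
  assume ?L
  then show ?R
    using onorm[of \<phi>] by (auto simp: support_functional_def linear_functional_iff)
next
  assume R: ?R
  have sc: "\<phi> (r *\<^sub>R x) = r *\<^sub>R \<phi> x" for r x
    using R smul_of_real[of r x] by (metis scaleR_conv_of_real)
  have bl: "bounded_linear \<phi>"
    by (rule bounded_linear_intro[where K = 1]) (use R sc in auto)
  moreover have "onorm \<phi> = 1"
    by (rule onorm_eq_1I[OF bl, where y = y]) (use R assms in auto)
  ultimately show ?L
    using R by (auto simp: support_functional_def linear_functional_iff)
qed

end

lemma semi_inner_product_iff:
  fixes smul :: "'k::{real_normed_field,conjugatable_field} \<Rightarrow> 'a::real_normed_vector \<Rightarrow> 'a"
  assumes "smooth_normed_space smul"
    and conj: "\<And>c::'k. c * conjugate c = of_real ((norm c)\<^sup>2)"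
  shows "semi_inner_product smul s \<longleftrightarrow>
    s = (\<lambda>x y. if y = 0 then 0 else of_real (norm y) * (THE \<phi>. support_functional smul y \<phi>) x)"
    (is "_ \<longleftrightarrow> s = ?t")
proof -
  interpret smooth_normed_space smul by fact
  define \<Phi> where "\<Phi> y = (THE \<phi>. support_functional smul y \<phi>)" for y
  have \<Phi>: "support_functional smul y (\<Phi> y)" if "y \<noteq> 0" for y
    unfolding \<Phi>_def using smooth[OF that] by (rule theI')
  have \<Phi>_unique: "\<Phi> y = \<phi>" if "y \<noteq> 0" "support_functional smul y \<phi>" for y \<phi>
    using smooth[OF that(1)] that(2) \<Phi>[OF that(1)] by blast
  have \<Phi>': "(\<forall>x z. \<Phi> y (x + z) = \<Phi> y x + \<Phi> y z) \<and> (\<forall>c x. \<Phi> y (smul c x) = c * \<Phi> y x) \<and>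
    (\<forall>x. norm (\<Phi> y x) \<le> norm x) \<and> \<Phi> y y = of_real (norm y)" if "y \<noteq> 0" for y
    using \<Phi>[OF that] support_functional_iff[OF that] by blast
  have uniq: "s = ?t" if s: "semi_inner_product smul s" for s
  proof (intro ext)
    fix x y
    note s' = s[unfolded semi_inner_product_def]
    show "s x y = ?t x y"
    proof (cases "y = 0")
      case True
      have "s x (smul 0 y) = conjugate 0 * s x y"
        using s' by blast
      then show ?thesis
        using True by simp
    next
      case False
      have "s y y = of_real ((norm y)\<^sup>2)"
      proof -
        obtain r where r: "r > 0" "s y y = of_real r"
          using s' False by blast
        have "sqrt (norm (s y y)) = norm y"
          using s' by blast
        then have "sqrt r = norm y"
          using r by simp
        then have "r = (norm y)\<^sup>2"
          using r by (metis less_imp_le real_sqrt_pow2)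
        with r show ?thesis by simp
      qed
      moreover have "norm (s x y) \<le> norm x * norm y" for x
        using s' by metis
      ultimately have "support_functional smul y (\<lambda>x. s x y / of_real (norm y))"
        using s' False
        by (auto simp: support_functional_iff add_divide_distrib norm_divide divide_le_eq
            power2_eq_square)
      then have "\<Phi> y = (\<lambda>x. s x y / of_real (norm y))"
        by (rule \<Phi>_unique[OF False])
      then show ?thesis
        using False by (simp add: \<Phi>_def[symmetric])
    qed
  qed
  have norm_conj: "norm (conjugate c) = norm c" for c :: 'k
  proof (cases "c = 0")
    case False
    have "norm c * norm (conjugate c) = norm c * norm c"
      using arg_cong[OF conj[of c], of norm]
      by (simp add: norm_mult power2_eq_square)
    then show ?thesis
      using False by simp
  qed simp
  have "semi_inner_product smul ?t"
  proof -
    have t_eq: "?t = (\<lambda>x y. if y = 0 then 0 else of_real (norm y) * \<Phi> y x)"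
      by (simp add: \<Phi>_def fun_eq_iff)
    have hom: "of_real (norm (smul c y)) * \<Phi> (smul c y) x = conjugate c * (of_real (norm y) * \<Phi> y x)"
      if "y \<noteq> 0" "c \<noteq> 0" for c x y
    proof -
      have nz: "smul c y \<noteq> 0"
        using that by simp
      have "support_functional smul (smul c y) (\<lambda>x. conjugate c / of_real (norm c) * \<Phi> y x)"
        unfolding support_functional_iff[OF nz]
        using \<Phi>'[OF that(1)] that conj[of c]
        by (auto simp: algebra_simps norm_mult norm_divide norm_conj norm_smul power2_eq_square
            divide_simps)
      then have "\<Phi> (smul c y) = (\<lambda>x. conjugate c / of_real (norm c) * \<Phi> y x)"
        by (rule \<Phi>_unique[OF nz])
      then show ?thesis
        using that by (simp add: norm_smul)
    qed
    have \<Phi>0: "\<Phi> y 0 = 0" if "y \<noteq> 0" for y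
      using \<Phi>'[OF that] by (metis add_cancel_left_left)
    have pos: "\<Phi> x x = of_real (norm x)" if "x \<noteq> 0" for x
      using \<Phi>'[OF that] by blast
    have sq: "sqrt (norm (if x = 0 then 0 else of_real (norm x) * \<Phi> x x)) = norm x" for x
      by (simp add: pos norm_mult)
    show ?thesis
      unfolding t_eq semi_inner_product_def sq
    proof (intro conjI allI impI)
      fix x y z
      show "(if z = 0 then 0 else of_real (norm z) * \<Phi> z (x + y)) =
        (if z = 0 then 0 else of_real (norm z) * \<Phi> z x) +
        (if z = 0 then 0 else of_real (norm z) * \<Phi> z y)"
        using \<Phi>'[of z] by (simp add: algebra_simps)
    next
      fix c x y
      show "(if y = 0 then 0 else of_real (norm y) * \<Phi> y (smul c x)) =
        c * (if y = 0 then 0 else of_real (norm y) * \<Phi> y x)"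
        using \<Phi>'[of y] by simp
      show "(if smul c y = 0 then 0 else of_real (norm (smul c y)) * \<Phi> (smul c y) x) =
        conjugate c * (if y = 0 then 0 else of_real (norm y) * \<Phi> y x)"
        using hom[of y c x] by auto
    next
      fix x :: 'a
      assume "x \<noteq> 0"
      then show "\<exists>r>0. (if x = 0 then 0 else of_real (norm x) * \<Phi> x x) = of_real r"
        by (intro exI[of _ "norm x * norm x"]) (simp add: pos)
    next
      fix x y
      show "norm (if y = 0 then 0 else of_real (norm y) * \<Phi> y x) \<le> norm x * norm y"
        using \<Phi>'[of y] by (auto simp: norm_mult mult.commute intro!: mult_right_mono)
    qed (rule refl)
  qed
  with uniq show ?thesis
    by blast
qed

lemma sip_real:
  assumes "smooth_normed_space (smul :: real \<Rightarrow> 'a::real_normed_vector \<Rightarrow> 'a)"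
  shows "semi_inner_product smul s \<longleftrightarrow> s = sip smul"
    and "sip smul =
      (\<lambda>x y. if y = 0 then 0 else norm y * (THE \<phi>. support_functional smul y \<phi>) x)"
proof -
  have iff: "semi_inner_product smul s \<longleftrightarrow>
      s = (\<lambda>x y. if y = 0 then 0 else norm y * (THE \<phi>. support_functional smul y \<phi>) x)" for s
    using semi_inner_product_iff[OF assms, of s] by (simp add: power2_eq_square of_real_eq_id cong: if_cong)
  then show "sip smul =
      (\<lambda>x y. if y = 0 then 0 else norm y * (THE \<phi>. support_functional smul y \<phi>) x)"
    by (simp add: sip_def)
  with iff show "semi_inner_product smul s \<longleftrightarrow> s = sip smul"
    by simp
qed

lemma sip_complex:
  assumes "smooth_normed_space (smul :: complex \<Rightarrow> 'a::real_normed_vector \<Rightarrow> 'a)"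
  shows "semi_inner_product smul s \<longleftrightarrow> s = sip smul"
    and "sip smul =
      (\<lambda>x y. if y = 0 then 0 else of_real (norm y) * (THE \<phi>. support_functional smul y \<phi>) x)"
proof -
  have iff: "semi_inner_product smul s \<longleftrightarrow> s =
      (\<lambda>x y. if y = 0 then 0 else of_real (norm y) * (THE \<phi>. support_functional smul y \<phi>) x)" for s
    by (rule semi_inner_product_iff[OF assms])
      (simp only: conjugate_complex_def complex_norm_square)
  then show "sip smul =
      (\<lambda>x y. if y = 0 then 0 else of_real (norm y) * (THE \<phi>. support_functional smul y \<phi>) x)"
    by (simp add: sip_def)
  with iff show "semi_inner_product smul s \<longleftrightarrow> s = sip smul"
    by simp
qed

end

theory Submission
  imports Defs
begin

text \<open>
  By the Hahn--Banach theorem and smoothness, every vector outside a plane is separated from it by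
  some \<open>s \<cdot> w\<close>, namely for \<open>w\<close> the difference to a best approximation. As \<open>f\<close> is surjective and
  preserves zeros of the semi-inner product, it therefore maps planes into planes. Evaluating
  \<open>f (x + b y) = \<alpha> f x + \<beta> f y\<close> against \<open>f w\<close>, where \<open>w\<close> is chosen such that
  \<open>s y w = \<omega> s x w\<close> with \<open>\<omega>\<close> prescribed, shows that up to phases \<open>f (a x + b y)\<close> is
  \<open>a f x + b \<theta> f y\<close> for all \<open>a\<close>, \<open>b\<close>, or the same with conjugated scalars. For a unit vector
  \<open>e\<close> and \<open>h\<close> in the kernel of \<open>s \<cdot> e\<close>, the image of the line through \<open>h\<close> contains exactly one
  \<open>V h\<close> with \<open>f (e + h)\<close> equal to \<open>f e + V h\<close> up to a phase; comparing the expansions of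
  \<open>f (e + h + k)\<close> gives additivity of \<open>V\<close>, and \<open>U (a e + h) = a f e + V h\<close>, with \<open>a\<close> possibly
  conjugated, is the required isometry.
\<close>

section \<open>The Hahn--Banach theorem\<close>

text \<open>Homogeneity is asked for as an inequality only, because that is what is easy to check
  for infima; equality is recovered by applying the inequality to \<open>inverse c\<close>.\<close>

definition sublinear :: "('a::real_vector \<Rightarrow> real) \<Rightarrow> bool" where
  "sublinear p \<longleftrightarrow> (\<forall>x y. p (x + y) \<le> p x + p y) \<and> (\<forall>c>0. \<forall>x. p (c *\<^sub>R x) \<le> c * p x)"

lemma sublinear_add: "sublinear p \<Longrightarrow> p (x + y) \<le> p x + p y"
  by (simp add: sublinear_def)

lemma sublinear_scale:
  assumes "sublinear p" "c > 0"
  shows "p (c *\<^sub>R x) = c * p x"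
proof (rule antisym)
  show "p (c *\<^sub>R x) \<le> c * p x"
    using assms by (simp add: sublinear_def)
  have "p (inverse c *\<^sub>R (c *\<^sub>R x)) \<le> inverse c * p (c *\<^sub>R x)"
    using assms unfolding sublinear_def by (meson positive_imp_inverse_positive)
  then show "c * p x \<le> p (c *\<^sub>R x)"
    using assms by (simp add: field_simps)
qed

lemma sublinear_zero:
  assumes "sublinear p"
  shows "p 0 = 0"
  using sublinear_scale[OF assms, of 2 0] by simp

lemma sublinear_ge:
  assumes "sublinear p"
  shows "- p (- x) \<le> p x"
  using sublinear_add[OF assms, of x "- x"] sublinear_zero[OF assms] by simp

text \<open>The largest decrease of \<open>q\<close> that can be had by moving along the ray of
  \<open>y\<close>. For a minimal \<open>q\<close> it cannot lower \<open>q\<close>, so the bound at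
  \<open>t = 1\<close> yields superadditivity; applied to the original \<open>p\<close> it forces
  the value of the final functional at a prescribed point.\<close>

lemma sublinear_shift:
  assumes q: "sublinear q"
  shows "\<exists>q'. sublinear q' \<and> (\<forall>x. q' x \<le> q x) \<and> (\<forall>x. q' x \<le> q (x + y) - q y)"
proof -
  define q' where "q' x = (INF t\<in>{0..}. q (x + t *\<^sub>R y) - t * q y)" for x
  have sc: "q (t *\<^sub>R x) = t * q x" if "t \<ge> 0" for t x
    using that sublinear_scale[OF q, of t x] sublinear_zero[OF q] by (cases "t = 0") auto
  have bdd: "bdd_below ((\<lambda>t. q (x + t *\<^sub>R y) - t * q y) ` {0..})" for x
  proof (rule bdd_belowI2)
    fix t :: real assume "t \<in> {0..}"
    then show "- q (- x) \<le> q (x + t *\<^sub>R y) - t * q y"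
      using sublinear_add[OF q, of "x + t *\<^sub>R y" "- x"] sc[of t y] by simp
  qed
  have le: "q' x \<le> q (x + t *\<^sub>R y) - t * q y" if "t \<ge> 0" for x t
    unfolding q'_def using that by (intro cINF_lower[OF bdd]) auto
  have ge: "c \<le> q' x" if "\<And>t. t \<ge> 0 \<Longrightarrow> c \<le> q (x + t *\<^sub>R y) - t * q y" for x c
    unfolding q'_def using that by (intro cINF_greatest) auto
  have "q' (x + z) \<le> q' x + q' z" for x z
  proof -
    \<comment> \<open>The two infima are taken one after the other, first over \<open>r\<close> with
      \<open>t\<close> fixed and then over \<open>t\<close>.\<close>
    have "q' (x + z) - (q (z + t *\<^sub>R y) - t * q y) \<le> q' x" if t: "t \<ge> 0" for t
    proof (rule ge)
      fix r :: real assume r: "r \<ge> 0"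
      have "q' (x + z) \<le> q ((x + z) + (r + t) *\<^sub>R y) - (r + t) * q y"
        using le r t by simp
      also have "(x + z) + (r + t) *\<^sub>R y = (x + r *\<^sub>R y) + (z + t *\<^sub>R y)"
        by (simp add: algebra_simps)
      finally show "q' (x + z) - (q (z + t *\<^sub>R y) - t * q y) \<le> q (x + r *\<^sub>R y) - r * q y"
        using sublinear_add[OF q, of "x + r *\<^sub>R y" "z + t *\<^sub>R y"] by (simp add: algebra_simps)
    qed
    then have "q' (x + z) - q' x \<le> q' z"
      by (intro ge) (simp add: algebra_simps)
    then show ?thesis by simp
  qed
  moreover have "q' (c *\<^sub>R x) \<le> c * q' x" if c: "c > 0" for c x
  proof -
    have "q' (c *\<^sub>R x) / c \<le> q' x"
    proof (rule ge)
      fix t :: real assume t: "t \<ge> 0"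
      have "q' (c *\<^sub>R x) \<le> q (c *\<^sub>R x + (c * t) *\<^sub>R y) - c * t * q y"
        using le[of "c * t" "c *\<^sub>R x"] c t by simp
      also have "c *\<^sub>R x + (c * t) *\<^sub>R y = c *\<^sub>R (x + t *\<^sub>R y)"
        by (simp add: algebra_simps)
      also have "q \<dots> = c * q (x + t *\<^sub>R y)"
        using sc c by simp
      finally show "q' (c *\<^sub>R x) / c \<le> q (x + t *\<^sub>R y) - t * q y"
        using c by (simp add: field_simps)
    qed
    then show ?thesis
      using c by (simp add: field_simps)
  qed
  ultimately have "sublinear q'"
    by (simp add: sublinear_def)
  moreover have "q' x \<le> q x" "q' x \<le> q (x + y) - q y" for x
    using le[of 0 x] le[of 1 x] by simp_all
  ultimately show ?thesis by blast
qed

text \<open>The pointwise infimum is a lower bound of the chain. It is finite because a member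
  \<open>q\<close> either lies above the fixed \<open>q0\<close> or satisfies
  \<open>- q0 (- x) \<le> - q (- x) \<le> q x\<close>. For subadditivity, the smaller of two members
  serves at both points.\<close>

lemma sublinear_Inf_chain:
  assumes "C \<noteq> {}" and sub: "\<And>q. q \<in> C \<Longrightarrow> sublinear q"
    and lin: "\<And>q r. q \<in> C \<Longrightarrow> r \<in> C \<Longrightarrow> q \<le> r \<or> r \<le> q"
  shows "\<exists>u. sublinear u \<and> (\<forall>q\<in>C. u \<le> q)"
proof -
  obtain q0 where q0: "q0 \<in> C"
    using assms(1) by blast
  define u where "u x = (INF q\<in>C. q x)" for x
  have bdd: "bdd_below ((\<lambda>q. q x) ` C)" for x
  proof (rule bdd_belowI2)
    fix q assume "q \<in> C"
    then consider "q \<le> q0" | "q0 \<le> q" using lin q0 by blast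
    then show "- \<bar>q0 (- x)\<bar> - \<bar>q0 x\<bar> \<le> q x"
    proof cases
      case 1
      then have "q (- x) \<le> q0 (- x)" by (rule le_funD)
      then show ?thesis using sublinear_ge[OF sub[OF \<open>q \<in> C\<close>], of x] by linarith
    next
      case 2
      then have "q0 x \<le> q x" by (rule le_funD)
      then show ?thesis by linarith
    qed
  qed
  have le: "u x \<le> q x" if "q \<in> C" for x q
    unfolding u_def using that by (intro cINF_lower[OF bdd])
  have ge: "c \<le> u x" if "\<And>q. q \<in> C \<Longrightarrow> c \<le> q x" for x c
    unfolding u_def using that assms(1) by (intro cINF_greatest) auto
  have "u (x + y) \<le> u x + u y" for x y
  proof -
    have "u (x + y) - r y \<le> u x" if r: "r \<in> C" for r
    proof (rule ge)
      fix q assume q: "q \<in> C"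
      have "\<exists>m\<in>C. m \<le> q \<and> m \<le> r"
        using lin[OF q r] q r by auto
      then obtain m where m: "m \<in> C" "m \<le> q" "m \<le> r" by blast
      then have "u (x + y) \<le> m x + m y"
        using le[OF m(1), of "x + y"] sublinear_add[OF sub[OF m(1)], of x y] by linarith
      then show "u (x + y) - r y \<le> q x"
        using le_funD[OF m(2), of x] le_funD[OF m(3), of y] by linarith
    qed
    then have "u (x + y) - u x \<le> u y"
      by (intro ge) (simp add: algebra_simps)
    then show ?thesis by simp
  qed
  moreover have "u (c *\<^sub>R x) \<le> c * u x" if c: "c > 0" for c x
  proof -
    have "u (c *\<^sub>R x) / c \<le> u x"
      using le c sublinear_scale[OF sub c]
      by (intro ge) (metis divide_le_eq mult.commute)
    then show ?thesis
      using c by (simp add: field_simps)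
  qed
  ultimately have "sublinear u"
    by (simp add: sublinear_def)
  then show ?thesis
    using le by (auto simp: le_fun_def)
qed

text \<open>A minimal sublinear functional is linear, and minimal ones exist by Zorn's lemma.\<close>

theorem hahn_banach:
  fixes p :: "'a::real_vector \<Rightarrow> real"
  assumes p: "sublinear p"
  shows "\<exists>\<phi>. linear \<phi> \<and> (\<forall>x. \<phi> x \<le> p x) \<and> \<phi> z = p z"
proof -
  \<comment> \<open>Everything below \<open>p1\<close> is at most \<open>- p z\<close> at
    \<open>- z\<close>, so a linear functional below \<open>p1\<close> is at least
    \<open>p z\<close> at \<open>z\<close>.\<close>
  obtain p1 where p1: "sublinear p1" "\<And>x. p1 x \<le> p x" "\<And>x. p1 x \<le> p (x + z) - p z"
    using sublinear_shift[OF p, of z] by blast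
  define A where "A = {q. sublinear q \<and> q \<le> p1}"
  \<comment> \<open>The order is reversed, so that the maximal element of Zorn's lemma is a minimal
    sublinear functional.\<close>
  have "\<exists>m\<in>A. \<forall>q\<in>A. q \<le> m \<longrightarrow> q = m"
  proof (rule predicate_Zorn[where P = "\<lambda>a b. b \<le> a"])
    show "partial_order_on A (relation_of (\<lambda>a b. b \<le> a) A)"
      by (rule partial_order_on_relation_ofI) auto
  next
    fix C assume C: "C \<in> Chains (relation_of (\<lambda>a b. b \<le> a) A)"
    show "\<exists>u\<in>A. \<forall>a\<in>C. u \<le> a"
    proof (cases "C = {}")
      case True
      then show ?thesis
        using p1(1) by (auto simp: A_def)
    next
      case False
      have CA: "q \<in> A" if "q \<in> C" for q
        using C that by (auto simp: Chains_def relation_of_def)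
      then have "\<exists>u. sublinear u \<and> (\<forall>q\<in>C. u \<le> q)"
        using C by (intro sublinear_Inf_chain[OF False]) (auto simp: A_def Chains_def relation_of_def)
      then obtain u where u: "sublinear u" "\<And>q. q \<in> C \<Longrightarrow> u \<le> q"
        by blast
      obtain q where q: "q \<in> C"
        using False by blast
      then have "u \<le> p1"
        using u(2)[OF q] CA[OF q] by (auto simp: A_def)
      then show ?thesis
        using u by (auto simp: A_def)
    qed
  qed
  then obtain m where m: "sublinear m" "m \<le> p1" and min: "\<And>q. sublinear q \<Longrightarrow> q \<le> m \<Longrightarrow> q = m"
    unfolding A_def by (metis (mono_tags, lifting) mem_Collect_eq order_trans)
  have add: "m (x + y) = m x + m y" for x y
  proof -
    \<comment> \<open>By minimality the shift by \<open>y\<close> is \<open>m\<close> itself, which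
      turns its second bound into the missing inequality
      \<open>m x + m y \<le> m (x + y)\<close>.\<close>
    obtain q where q: "sublinear q" "\<And>x. q x \<le> m x" "\<And>x. q x \<le> m (x + y) - m y"
      using sublinear_shift[OF m(1), of y] by blast
    then have "q = m" by (intro min) (auto simp: le_fun_def)
    then have "m x \<le> m (x + y) - m y" using q(3) by blast
    then show ?thesis using sublinear_add[OF m(1), of x y] by simp
  qed
  have neg: "m (- x) = - m x" for x
    using add[of x "- x"] sublinear_zero[OF m(1)] by simp
  have "m (c *\<^sub>R x) = c * m x" for c x
  proof -
    consider "c > 0" | "c = 0" | "- c > 0" by linarith
    then show ?thesis
    proof cases
      case 3
      then have "m (- c *\<^sub>R x) = - c * m x" by (rule sublinear_scale[OF m(1)])
      then show ?thesis using neg[of "c *\<^sub>R x"] by simp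
    qed (use sublinear_zero[OF m(1)] sublinear_scale[OF m(1)] in auto)
  qed
  then have lin: "linear m"
    using add by (intro linearI) auto
  have le: "m x \<le> p1 x" for x
    using m(2) by (rule le_funD)
  have "- m z \<le> - p z"
    using le[of "- z"] p1(3)[of "- z"] neg[of z] sublinear_zero[OF p] by simp
  moreover have "m x \<le> p x" for x
    using le[of x] p1(2)[of x] by linarith
  ultimately show ?thesis
    using lin by (intro exI[of _ m]) (auto intro: antisym)
qed

section \<open>Seminorms and norm-preserving functionals over real and complex scalars\<close>

definition seminorm_over :: "('k::real_normed_field \<Rightarrow> 'a::ab_group_add \<Rightarrow> 'a) \<Rightarrow> ('a \<Rightarrow> real) \<Rightarrow> bool"
  where "seminorm_over smul p \<longleftrightarrow>
    (\<forall>x y. p (x + y) \<le> p x + p y) \<and> (\<forall>c x. p (smul c x) = norm c * p x)"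

text \<open>Turned into a predicate so that all later arguments can be carried out for a general
  scalar field; only its two instances distinguish real from complex scalars.\<close>

definition hahn_banach_over :: "('k::real_normed_field \<Rightarrow> 'a::ab_group_add \<Rightarrow> 'a) \<Rightarrow> bool" where
  "hahn_banach_over smul \<longleftrightarrow> (\<forall>p z. seminorm_over smul p \<longrightarrow>
    (\<exists>\<psi>. (\<forall>x y. \<psi> (x + y) = \<psi> x + \<psi> y) \<and> (\<forall>c x. \<psi> (smul c x) = c * \<psi> x) \<and>
      (\<forall>x. norm (\<psi> x) \<le> p x) \<and> \<psi> z = of_real (p z)))"

lemma hahn_banach_over_real:
  "hahn_banach_over (scaleR :: real \<Rightarrow> 'a::real_vector \<Rightarrow> 'a)"
  unfolding hahn_banach_over_def
proof (intro allI impI)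
  fix p and z :: 'a assume p: "seminorm_over (scaleR :: real \<Rightarrow> 'a \<Rightarrow> 'a) p"
  then have "sublinear p"
    by (simp add: seminorm_over_def sublinear_def)
  then obtain \<phi> where \<phi>: "linear \<phi>" "\<And>x. \<phi> x \<le> p x" "\<phi> z = p z"
    using hahn_banach by blast
  have pm: "p (- x) = p x" for x
    using p unfolding seminorm_over_def by (metis abs_minus abs_one mult_1 real_norm_def scaleR_minus1_left)
  have "norm (\<phi> x) \<le> p x" for x
    using \<phi>(2)[of x] \<phi>(2)[of "- x"] linear_neg[OF \<phi>(1), of x] pm[of x] by simp
  then show "\<exists>\<psi>. (\<forall>x y. \<psi> (x + y) = \<psi> x + \<psi> y) \<and> (\<forall>c x. \<psi> (c *\<^sub>R x) = c * \<psi> x) \<and>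
      (\<forall>x. norm (\<psi> x) \<le> p x) \<and> \<psi> z = of_real (p z)"
    using \<phi> linear_add[OF \<phi>(1)] linear_scale[OF \<phi>(1)] by (intro exI[of _ \<phi>]) auto
qed

lemma hahn_banach_over_complex:
  fixes smul :: "complex \<Rightarrow> 'a::real_normed_vector \<Rightarrow> 'a"
  assumes "normed_space_over smul"
  shows "hahn_banach_over smul"
  unfolding hahn_banach_over_def
proof (intro allI impI)
  fix p and z :: 'a assume p: "seminorm_over smul p"
  interpret normed_space_over smul by fact
  have p_add: "p (x + y) \<le> p x + p y" and p_smul: "p (smul c x) = cmod c * p x" for x y c
    using p by (auto simp: seminorm_over_def)
  have "sublinear p"
    using p_smul[of "of_real c" for c] unfolding smul_of_real by (simp add: sublinear_def p_add)
  then obtain \<phi> where \<phi>: "linear \<phi>" "\<And>x. \<phi> x \<le> p x" "\<phi> z = p z"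
    using hahn_banach by blast
  \<comment> \<open>The complex linear functional is determined by its real part
    \<open>\<phi>\<close>, as \<open>Im (\<psi> x) = - Re (\<psi> (smul \<i> x))\<close>.\<close>
  define \<psi> where "\<psi> x = Complex (\<phi> x) (- \<phi> (smul \<i> x))" for x
  have add: "\<psi> (x + y) = \<psi> x + \<psi> y" for x y
    using linear_add[OF \<phi>(1)] by (simp add: \<psi>_def scale_right_distrib complex_eq_iff)
  have scale: "\<psi> (smul c x) = c * \<psi> x" for c x
  proof -
    have c: "c = of_real (Re c) + of_real (Im c) * \<i>"
      by (simp add: complex_eq_iff)
    have ic: "\<i> * c = of_real (- Im c) + of_real (Re c) * \<i>"
      by (simp add: complex_eq_iff)
    have "smul c x = Re c *\<^sub>R x + Im c *\<^sub>R smul \<i> x"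
      unfolding smul_of_real[symmetric] scale_scale scale_left_distrib[symmetric] c[symmetric] ..
    then have 1: "\<phi> (smul c x) = Re c * \<phi> x + Im c * \<phi> (smul \<i> x)"
      by (simp only: linear_add[OF \<phi>(1)] linear_scale[OF \<phi>(1)] real_scaleR_def)
    have "smul \<i> (smul c x) = - Im c *\<^sub>R x + Re c *\<^sub>R smul \<i> x"
      unfolding smul_of_real[symmetric] scale_scale scale_left_distrib[symmetric] ic[symmetric] ..
    then have 2: "\<phi> (smul \<i> (smul c x)) = - Im c * \<phi> x + Re c * \<phi> (smul \<i> x)"
      by (simp only: linear_add[OF \<phi>(1)] linear_scale[OF \<phi>(1)] real_scaleR_def)
    show ?thesis
      unfolding \<psi>_def 1 2 by (simp add: complex_eq_iff algebra_simps)
  qed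
  have bound: "cmod (\<psi> x) \<le> p x" for x
  proof (cases "\<psi> x = 0")
    case True
    then have "\<phi> x = 0"
      by (simp add: \<psi>_def complex_eq_iff)
    then show ?thesis
      using \<phi>(2)[of x] True by simp
  next
    case False
    \<comment> \<open>Rotating \<open>x\<close> by this unimodular scalar makes the value of
      \<open>\<psi>\<close> real and nonnegative, so that the bound for the real part
      applies.\<close>
    define u where "u = of_real (cmod (\<psi> x)) / \<psi> x"
    have "\<phi> (smul u x) = Re (\<psi> (smul u x))"
      unfolding \<psi>_def complex.sel ..
    also have "\<psi> (smul u x) = of_real (cmod (\<psi> x))"
      unfolding scale u_def using False by simp
    finally have "cmod (\<psi> x) = \<phi> (smul u x)"
      unfolding Re_complex_of_real by (rule sym)
    also have "\<dots> \<le> p (smul u x)" by (rule \<phi>(2))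
    also have "\<dots> = p x"
      using False by (simp add: p_smul u_def norm_divide)
    finally show ?thesis .
  qed
  \<comment> \<open>The real part of \<open>\<psi> z\<close> is already as large as the modulus may
    be, which leaves no room for an imaginary part.\<close>
  have "\<psi> z = of_real (p z)"
  proof -
    have Re: "Re (\<psi> z) = p z"
      by (simp add: \<psi>_def \<phi>)
    then have "(cmod (\<psi> z))\<^sup>2 \<le> (Re (\<psi> z))\<^sup>2"
      using bound[of z] by (intro power_mono) auto
    then have "Im (\<psi> z) = 0"
      by (simp add: cmod_power2)
    then show ?thesis
      using Re by (simp add: complex_eq_iff)
  qed
  then show "\<exists>\<psi>. (\<forall>x y. \<psi> (x + y) = \<psi> x + \<psi> y) \<and> (\<forall>c x. \<psi> (smul c x) = c * \<psi> x) \<and>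
      (\<forall>x. cmod (\<psi> x) \<le> p x) \<and> \<psi> z = of_real (p z)"
    using add scale bound by blast
qed

section \<open>Separating a vector from a plane by the semi-inner product\<close>

text \<open>The quotient seminorm modulo the line through \<open>v\<close>. Besides the seminorm,
  the attainment of the infimum matters: it supplies best approximations as actual vectors, although
  the space may be incomplete. It comes from compactness of balls in the scalar field, the bound by
  the norm making \<open>p\<close> Lipschitz along the line.\<close>

lemma seminorm_quotient:
  fixes smul :: "'k::{real_normed_field,heine_borel} \<Rightarrow> 'a::real_normed_vector \<Rightarrow> 'a"
  assumes "normed_space_over smul" and p: "seminorm_over smul p" and le: "\<And>x. p x \<le> norm x"
  shows "\<exists>q. seminorm_over smul q \<and> (\<forall>x. q x \<le> p x) \<and> q v = 0 \<and> (\<forall>z. \<exists>b. q z = p (z + smul b v))"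
proof (cases "p v = 0")
  case True
  interpret normed_space_over smul by fact
  show ?thesis
    using p True by (intro exI[of _ p]) (auto intro!: exI[of _ 0])
next
  case False
  interpret normed_space_over smul by fact
  have p_add: "p (x + y) \<le> p x + p y" and p_smul: "p (smul c x) = norm c * p x" for x y c
    using p by (auto simp: seminorm_over_def)
  have p_minus: "p (- x) = p x" for x
    using p_smul[of "-1" x] by simp
  have p_diff: "p x - p y \<le> p (x - y)" for x y
    using p_add[of "x - y" y] by simp
  have pos: "p x \<ge> 0" for x
    using p_add[of x "- x"] p_minus[of x] p_smul[of 0 x] by simp
  then have pv: "p v > 0"
    using False by (simp add: less_le)
  have lip: "\<bar>p (z + smul b v) - p (z + smul c v)\<bar> \<le> norm (b - c) * norm v" for z b c
  proof -
    have "\<bar>p x - p y\<bar> \<le> norm (x - y)" for x y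
      using p_diff[of x y] p_diff[of y x] le[of "x - y"] p_minus[of "x - y"] by simp
    from this[of "z + smul b v" "z + smul c v"] show ?thesis
      by (simp add: scale_left_diff_distrib[symmetric] norm_smul)
  qed
  have cont: "continuous_on UNIV (\<lambda>b. p (z + smul b v))" for z
  proof (rule continuous_on_iff[THEN iffD2], intro ballI allI impI)
    fix c :: 'k and e :: real assume e: "e > 0"
    have nv: "norm v > 0" using pv le[of v] by linarith
    show "\<exists>d>0. \<forall>b\<in>UNIV. dist b c < d \<longrightarrow> dist (p (z + smul b v)) (p (z + smul c v)) < e"
    proof (intro exI[of _ "e / norm v"] conjI ballI impI)
      show "e / norm v > 0" using e nv by simp
      fix b assume "dist b c < e / norm v"
      then have "norm (b - c) * norm v < e"
        using nv by (simp add: dist_norm field_simps)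
      then show "dist (p (z + smul b v)) (p (z + smul c v)) < e"
        using lip[of z b c] by (simp add: dist_real_def)
    qed
  qed
  have "\<exists>b. \<forall>c. p (z + smul b v) \<le> p (z + smul c v)" for z
  proof -
    \<comment> \<open>For \<open>norm c > R\<close> the triangle inequality gives
      \<open>p (z + smul c v) > p z\<close>, the value at \<open>c = 0\<close>, so a minimum over
      the ball is a global one.\<close>
    define R where "R = 2 * p z / p v"
    have R: "R \<ge> 0" using pos pv by (simp add: R_def)
    then have "\<exists>b\<in>cball (0::'k) R. \<forall>c\<in>cball 0 R. p (z + smul b v) \<le> p (z + smul c v)"
      by (intro continuous_attains_inf continuous_on_subset[OF cont]) auto
    then obtain b where b: "\<And>c. norm c \<le> R \<Longrightarrow> p (z + smul b v) \<le> p (z + smul c v)"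
      by (meson mem_cball_0)
    have "p (z + smul b v) \<le> p (z + smul c v)" for c
    proof (cases "norm c \<le> R")
      case True
      then show ?thesis by (rule b)
    next
      case False
      then have "2 * p z < norm c * p v"
        using pv by (simp add: R_def field_simps)
      also have "\<dots> = p (smul c v)" by (simp add: p_smul)
      also have "\<dots> \<le> p (z + smul c v) + p z"
        using p_add[of "z + smul c v" "- z"] p_minus[of z] by simp
      finally show ?thesis
        using b[of 0] R by simp
    qed
    then show ?thesis by blast
  qed
  then obtain B where B: "\<And>z c. p (z + smul (B z) v) \<le> p (z + smul c v)"
    by metis
  define q where "q z = p (z + smul (B z) v)" for z
  have q_le: "q z \<le> p (z + smul c v)" for z c
    using B by (simp add: q_def)
  have "q (x + y) \<le> q x + q y" for x y
  proof -
    have "q (x + y) \<le> p ((x + y) + smul (B x + B y) v)" by (rule q_le)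
    also have "(x + y) + smul (B x + B y) v = (x + smul (B x) v) + (y + smul (B y) v)"
      by (simp add: scale_left_distrib)
    also have "p \<dots> \<le> q x + q y"
      using p_add by (simp add: q_def)
    finally show ?thesis .
  qed
  moreover have q_smul: "q (smul c x) \<le> norm c * q x" for c x
    using q_le[of "smul c x" "c * B x"] p_smul[of c "x + smul (B x) v"]
    by (simp add: q_def scale_right_distrib)
  moreover have "norm c * q x \<le> q (smul c x)" for c x
  proof (cases "c = 0")
    case True
    then show ?thesis using pos by (simp add: q_def)
  next
    case False
    then show ?thesis
      using q_smul[of "inverse c" "smul c x"] by (simp add: norm_divide field_simps)
  qed
  ultimately have "seminorm_over smul q"
    by (simp add: seminorm_over_def antisym)
  moreover have "q x \<le> p x" for x
    using q_le[of x 0] by simp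
  moreover have "q v = 0"
    using q_le[of v "-1"] p_smul[of 0 v] pos by (intro antisym) (auto simp: q_def)
  ultimately show ?thesis
    by (intro exI[of _ q]) (auto simp: q_def)
qed

text \<open>The vectors \<open>x\<close> and \<open>y\<close> may be dependent; with
  \<open>x = y\<close> the same condition separates a vector from a line.\<close>

definition separating ::
    "('k::real_normed_field \<Rightarrow> 'a::real_normed_vector \<Rightarrow> 'a) \<Rightarrow> ('a \<Rightarrow> 'a \<Rightarrow> 'k) \<Rightarrow> bool" where
  "separating smul s \<longleftrightarrow>
    (\<forall>x y z. (\<forall>a b. z \<noteq> smul a x + smul b y) \<longrightarrow> (\<exists>w. s x w = 0 \<and> s y w = 0 \<and> s z w \<noteq> 0))"

text \<open>
  The point \<open>w\<close> is \<open>z\<close> minus a best approximation to it from the plane: the functional of norm at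
  most one that annihilates the plane and attains the distance at \<open>z\<close> supports \<open>w\<close>, hence
  represents \<open>s \<cdot> w\<close> by smoothness.
\<close>

lemma separating_sip:
  fixes smul :: "'k::{real_normed_field,conjugatable_field,heine_borel} \<Rightarrow> 'a::real_normed_vector \<Rightarrow> 'a"
  assumes sm: "smooth_normed_space smul"
    and conj: "\<And>c::'k. c * conjugate c = of_real ((norm c)\<^sup>2)"
    and hb: "hahn_banach_over smul"
    and s: "semi_inner_product smul s"
  shows "separating smul s"
  unfolding separating_def
proof (intro allI impI)
  interpret smooth_normed_space smul by fact
  fix x y z assume z: "\<forall>a b. z \<noteq> smul a x + smul b y"
  have n: "seminorm_over smul norm"
    by (simp add: seminorm_over_def norm_smul norm_triangle_ineq)
  \<comment> \<open>Dividing out \<open>x\<close> and then \<open>y\<close> gives a seminorm that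
    vanishes on the plane; since both infima are attained, its value at \<open>z\<close> is the norm
    of an explicit vector \<open>w\<close> in the coset of \<open>z\<close>.\<close>
  obtain p where p: "seminorm_over smul p" "\<And>u. p u \<le> norm u" "p x = 0"
    "\<And>u. \<exists>a. p u = norm (u + smul a x)"
    using seminorm_quotient[OF normed_space_over_axioms n, of x] by auto
  obtain q where q: "seminorm_over smul q" "\<And>u. q u \<le> p u" "q y = 0"
    "\<And>u. \<exists>b. q u = p (u + smul b y)"
    using seminorm_quotient[OF normed_space_over_axioms p(1,2), of y] by auto
  obtain \<psi> where \<psi>: "\<And>u v. \<psi> (u + v) = \<psi> u + \<psi> v" "\<And>c u. \<psi> (smul c u) = c * \<psi> u"
    "\<And>u. norm (\<psi> u) \<le> q u" "\<psi> z = of_real (q z)"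
    using hb q(1) unfolding hahn_banach_over_def by blast
  obtain a b where ab: "q z = norm (z + smul b y + smul a x)"
    using p(4) q(4) by metis
  define w where "w = z + smul b y + smul a x"
  have "norm (\<psi> x) \<le> 0" "norm (\<psi> y) \<le> 0"
    using \<psi>(3)[of x] \<psi>(3)[of y] q(2)[of x] q(3) p(3) by linarith+
  then have \<psi>0: "\<psi> x = 0" "\<psi> y = 0"
    by simp_all
  have w0: "w \<noteq> 0"
  proof
    assume "w = 0"
    then have "z = smul (- a) x + smul (- b) y"
      by (simp add: w_def scale_minus_left algebra_simps eq_neg_iff_add_eq_0)
    with z show False by blast
  qed
  have \<psi>w: "\<psi> w = of_real (norm w)"
    using \<psi> \<psi>0 ab by (simp add: w_def)
  have "norm (\<psi> u) \<le> norm u" for u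
    using \<psi>(3)[of u] q(2)[of u] p(2)[of u] by linarith
  then have "support_functional smul w \<psi>"
    using \<psi> \<psi>w by (simp add: support_functional_iff[OF w0])
  then have "(THE \<phi>. support_functional smul w \<phi>) = \<psi>"
    using smooth[OF w0] by (metis the_equality)
  moreover have "s = (\<lambda>x y. if y = 0 then 0 else of_real (norm y) * (THE \<phi>. support_functional smul y \<phi>) x)"
    using semi_inner_product_iff[OF sm conj] s by blast
  ultimately have "s u w = of_real (norm w) * \<psi> u" for u
    using w0 by simp
  moreover have "\<psi> z = of_real (norm w)"
    using \<psi>(4) ab by (simp add: w_def)
  ultimately show "\<exists>w. s x w = 0 \<and> s y w = 0 \<and> s z w \<noteq> 0"
    using w0 \<psi>0 by (intro exI[of _ w]) simp
qed

section \<open>Maps preserving the modulus of the semi-inner product\<close>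

lemma conjugate_one:
  "conjugate (1::'k::conjugatable_field) = 1"
proof -
  have "conjugate (1::'k) * conjugate 1 = conjugate 1"
    by (simp flip: conjugate_dist_mul)
  then show ?thesis
    by (metis conjugate_zero_iff mult_cancel_left1 zero_neq_one)
qed

text \<open>This identity is the only link between conjugation and the norm that the argument uses,
  and it holds for both scalar fields. The parameter \<open>k\<close> serves to fix the scalar
  type.\<close>

locale norm_conjugate =
  fixes k :: "'k::{real_normed_field,conjugatable_field} itself"
  assumes conj: "(c::'k) * conjugate c = of_real ((norm c)\<^sup>2)"
begin

lemma norm_conj:
  "norm (conjugate (c::'k)) = norm c"
proof (cases "c = 0")
  case False
  have "norm c * norm (conjugate c) = norm c * norm c"
    using arg_cong[OF conj[of c], of norm] by (simp add: norm_mult power2_eq_square)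
  then show ?thesis
    using False by simp
qed simp

text \<open>Both \<open>b\<close> and its conjugate are roots of a quadratic polynomial that is determined by the two norms.\<close>

lemma eq_or_conjugate:
  fixes a b :: 'k
  assumes "norm a = norm b" "norm (1 + a) = norm (1 + b)"
  shows "a = b \<or> a = conjugate b"
proof -
  have 1: "a * conjugate a = b * conjugate b"
    by (simp add: conj assms)
  have "(1 + a) * conjugate (1 + a) = (1 + b) * conjugate (1 + b)"
    by (simp only: conj assms)
  then have 2: "a + conjugate a = b + conjugate b"
    using 1 by (simp add: conjugate_dist_add conjugate_one algebra_simps)
  have "(a - b) * (a - conjugate b) = a * a - a * (b + conjugate b) + b * conjugate b"
    by (simp add: algebra_simps)
  also have "\<dots> = 0"
    unfolding 1[symmetric] 2[symmetric] by (simp add: algebra_simps)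
  finally show ?thesis by simp
qed

text \<open>A single non-self-conjugate scalar \<open>\<omega>\<close> forces the same choice for all \<open>b\<close>.\<close>

lemma uniform_conjugation:
  fixes \<gamma> :: "'k \<Rightarrow> 'k"
  assumes \<gamma>: "\<And>b. \<gamma> b = b \<or> \<gamma> b = conjugate b"
    and \<kappa>: "\<And>\<omega>. \<exists>\<kappa>. \<forall>b. \<kappa> * \<gamma> b = \<omega> * b \<or> \<kappa> * \<gamma> b = conjugate (\<omega> * b)"
  shows "\<gamma> = (\<lambda>b. b) \<or> \<gamma> = conjugate"
proof (cases "\<forall>\<omega>::'k. conjugate \<omega> = \<omega>")
  case True
  then show ?thesis using \<gamma> by auto
next
  case False
  then obtain \<omega> :: 'k where \<omega>: "conjugate \<omega> \<noteq> \<omega>" by blast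
  then have \<omega>0: "\<omega> \<noteq> 0" by auto
  obtain \<kappa> where k: "\<And>b. \<kappa> * \<gamma> b = \<omega> * b \<or> \<kappa> * \<gamma> b = conjugate \<omega> * conjugate b"
    using \<kappa>[of \<omega>] by (auto simp: conjugate_dist_mul)
  have "\<gamma> 1 = 1"
    using \<gamma>[of 1] by (auto simp: conjugate_one)
  then have "\<kappa> = \<omega> \<or> \<kappa> = conjugate \<omega>"
    using k[of 1] by (auto simp: conjugate_one)
  then show ?thesis
  proof
    assume "\<kappa> = \<omega>"
    \<comment> \<open>If \<open>\<gamma> b = conjugate b \<noteq> b\<close>, then
      \<open>\<omega> * conjugate b\<close> would be \<open>\<omega> * b\<close> or
      \<open>conjugate \<omega> * conjugate b\<close>; both are excluded by
      \<open>\<omega> \<noteq> 0\<close> and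
      \<open>conjugate \<omega> \<noteq> \<omega>\<close>.\<close>
    then have "\<gamma> b = b" for b
      using k[of b] \<gamma>[of b] \<omega> \<omega>0 by auto
    then show ?thesis by auto
  next
    assume "\<kappa> = conjugate \<omega>"
    then have "\<gamma> b = conjugate b" for b
      using k[of b] \<gamma>[of b] \<omega> \<omega>0 by auto
    then show ?thesis by auto
  qed
qed

definition id_or_conj :: "('k \<Rightarrow> 'k) \<Rightarrow> bool" where
  "id_or_conj J \<longleftrightarrow> J = (\<lambda>b. b) \<or> J = conjugate"

lemma id_or_conj_simps:
  assumes "id_or_conj J"
  shows "J (a + b) = J a + J b" "J (a * b) = J a * J b" "J 0 = 0" "J 1 = 1"
    "norm (J a) = norm a" "J (J a) = a"
  using assms
  by (auto simp: id_or_conj_def conjugate_dist_add conjugate_dist_mul conjugate_one norm_conj)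

end

section \<open>Linear independence of two and three vectors\<close>

text \<open>Stated for a pair instead of a set, so that a repeated vector counts as
  dependent.\<close>

definition indep2 :: "('k::field \<Rightarrow> 'a::ab_group_add \<Rightarrow> 'a) \<Rightarrow> 'a \<Rightarrow> 'a \<Rightarrow> bool" where
  "indep2 smul u v \<longleftrightarrow> (\<forall>a b. smul a u + smul b v = 0 \<longrightarrow> a = 0 \<and> b = 0)"

definition indep3 :: "('k::field \<Rightarrow> 'a::ab_group_add \<Rightarrow> 'a) \<Rightarrow> 'a \<Rightarrow> 'a \<Rightarrow> 'a \<Rightarrow> bool" where
  "indep3 smul u v w \<longleftrightarrow>
    (\<forall>a b c. smul a u + smul b v + smul c w = 0 \<longrightarrow> a = 0 \<and> b = 0 \<and> c = 0)"

context vector_space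
begin

lemma indep2D:
  assumes "indep2 scale u v" "scale a u + scale b v = scale a' u + scale b' v"
  shows "a = a'" "b = b'"
proof -
  have "scale (a - a') u + scale (b - b') v = 0"
    using assms(2) by (simp add: scale_left_diff_distrib algebra_simps)
  then show "a = a'" "b = b'"
    using assms(1) unfolding indep2_def by (metis eq_iff_diff_eq_0)+
qed

lemma indep3D:
  assumes "indep3 scale u v w"
    and "scale a u + scale b v + scale c w = scale a' u + scale b' v + scale c' w"
  shows "a = a'" "b = b'" "c = c'"
proof -
  have "scale (a - a') u + scale (b - b') v + scale (c - c') w = 0"
    using assms(2) by (simp add: scale_left_diff_distrib algebra_simps)
  then show "a = a'" "b = b'" "c = c'"
    using assms(1) unfolding indep3_def by (metis eq_iff_diff_eq_0)+
qed

lemma indep2I: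
  assumes "u \<noteq> 0" "\<And>c. v \<noteq> scale c u"
  shows "indep2 scale u v"
  unfolding indep2_def
proof (intro allI impI)
  fix a b assume eq: "scale a u + scale b v = 0"
  have b: "b = 0"
  proof (rule ccontr)
    assume b: "b \<noteq> 0"
    have "scale b v = scale (- a) u"
      using eq by (simp add: eq_neg_iff_add_eq_0 add.commute)
    then have "scale (inverse b) (scale b v) = scale (inverse b * - a) u"
      by simp
    then show False
      using b assms(2)[of "inverse b * - a"] by simp
  qed
  with eq assms(1) show "a = 0 \<and> b = 0" by simp
qed

lemma indep2_not_multiple:
  assumes "indep2 scale u v"
  shows "u \<noteq> 0" "v \<noteq> scale c u" "u \<noteq> scale c v"
proof -
  show "u \<noteq> 0"
    using indep2D(1)[OF assms, of 1 0 0 0] by auto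
  show "v \<noteq> scale c u"
    using indep2D(2)[OF assms, of 0 1 c 0] by auto
  show "u \<noteq> scale c v"
    using indep2D(1)[OF assms, of 1 0 0 c] by auto
qed

lemma indep2_scale:
  assumes "indep2 scale u v" "c \<noteq> 0" "d \<noteq> 0"
  shows "indep2 scale (scale c u) (scale d v)"
  using assms unfolding indep2_def by (metis mult_eq_0_iff scale_scale)

lemma indep3I:
  assumes "indep2 scale u v" "\<And>a b. w \<noteq> scale a u + scale b v"
  shows "indep3 scale u v w"
  unfolding indep3_def
proof (intro allI impI)
  fix a b c assume eq: "scale a u + scale b v + scale c w = 0"
  have c: "c = 0"
  proof (rule ccontr)
    assume c: "c \<noteq> 0"
    have "scale c w = scale (- a) u + scale (- b) v"
      using eq by (simp add: eq_neg_iff_add_eq_0 algebra_simps)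
    then have "scale (inverse c) (scale c w) = scale (inverse c) (scale (- a) u + scale (- b) v)"
      by (rule arg_cong)
    then have "w = scale (inverse c * - a) u + scale (inverse c * - b) v"
      using c by (simp add: scale_right_distrib scale_right_diff_distrib)
    then show False
      using assms(2) by blast
  qed
  with eq assms(1) show "a = 0 \<and> b = 0 \<and> c = 0"
    unfolding indep2_def by simp
qed

lemma indep3_scale:
  assumes "indep3 scale u v w" "c \<noteq> 0" "d \<noteq> 0"
  shows "indep3 scale u (scale c v) (scale d w)"
  using assms unfolding indep3_def by (metis mult_eq_0_iff scale_scale)

end

text \<open>Smoothness and Hahn--Banach enter only through the two separation hypotheses; everything
  in the locale is algebra with them.\<close>

locale sip_modulus_map =
  norm_conjugate "TYPE('k)" + X: normed_space_over sX + Y: normed_space_over sY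
  for sX :: "'k::{real_normed_field,conjugatable_field} \<Rightarrow> 'a::real_normed_vector \<Rightarrow> 'a"
    and sY :: "'k \<Rightarrow> 'b::real_normed_vector \<Rightarrow> 'b" +
  fixes s :: "'a \<Rightarrow> 'a \<Rightarrow> 'k" and t :: "'b \<Rightarrow> 'b \<Rightarrow> 'k" and f :: "'a \<Rightarrow> 'b"
  assumes sip_X: "semi_inner_product sX s" and sip_Y: "semi_inner_product sY t"
    and sep_X: "separating sX s" and sep_Y: "separating sY t"
    and surj: "surj f" and modulus: "norm (t (f x) (f y)) = norm (s x y)"
begin

lemma s_add: "s (x + y) w = s x w + s y w" and s_scale: "s (sX c x) w = c * s x w"
  and s_self: "norm (s x x) = (norm x)\<^sup>2"
proof -
  have "sqrt (norm (s x x)) = norm x"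
    using sip_X by (simp add: semi_inner_product_def)
  then show "norm (s x x) = (norm x)\<^sup>2"
    by (metis norm_ge_zero real_sqrt_pow2)
qed (use sip_X in \<open>simp_all add: semi_inner_product_def\<close>)

lemma t_add: "t (u + v) w = t u w + t v w" and t_scale: "t (sY c u) w = c * t u w"
  and t_self: "norm (t u u) = (norm u)\<^sup>2"
proof -
  have "sqrt (norm (t u u)) = norm u"
    using sip_Y by (simp add: semi_inner_product_def)
  then show "norm (t u u) = (norm u)\<^sup>2"
    by (metis norm_ge_zero real_sqrt_pow2)
qed (use sip_Y in \<open>simp_all add: semi_inner_product_def\<close>)

section \<open>Preservation of planes and of independence\<close>

lemma modulus_0: "t (f x) (f y) = 0 \<longleftrightarrow> s x y = 0"
  using modulus[of x y] by (metis norm_eq_zero)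

lemma norm_f: "norm (f x) = norm x"
  using modulus[of x x] by (simp add: s_self t_self)

lemma f_eq_0_iff: "f x = 0 \<longleftrightarrow> x = 0"
  by (metis norm_eq_zero norm_f)

text \<open>Otherwise some \<open>w\<close> separates the image from the plane. By surjectivity
  \<open>w = f v\<close>, and zeros of the semi-inner product pull back: \<open>s \<cdot> v\<close>
  kills \<open>x\<close> and \<open>y\<close> but not their combination.\<close>

lemma f_in_span:
  "\<exists>\<alpha> \<beta>. f (sX a x + sX b y) = sY \<alpha> (f x) + sY \<beta> (f y)"
proof (rule ccontr)
  assume "\<not> ?thesis"
  then obtain w where w: "t (f x) w = 0" "t (f y) w = 0" "t (f (sX a x + sX b y)) w \<noteq> 0"
    using sep_Y unfolding separating_def by blast
  obtain v where v: "w = f v"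
    using surj by (metis surjD)
  show False
    using w by (simp add: v modulus_0 s_add s_scale)
qed

text \<open>The same argument backwards: the separating vector now lies in the domain and is pushed
  forward. This yields that \<open>f\<close> preserves independence.\<close>

lemma in_span_if_f_in_span:
  assumes "f z = sY \<alpha> (f x) + sY \<beta> (f y)"
  shows "\<exists>a b. z = sX a x + sX b y"
proof (rule ccontr)
  assume "\<not> ?thesis"
  then obtain w where w: "s x w = 0" "s y w = 0" "s z w \<noteq> 0"
    using sep_X unfolding separating_def by blast
  have "t (f x) (f w) = 0" "t (f y) (f w) = 0"
    using w by (simp_all add: modulus_0)
  then have "t (f z) (f w) = 0"
    by (simp add: assms t_add t_scale)
  with w show False
    by (simp add: modulus_0)
qed

lemma f_indep2:
  assumes "indep2 sX x y"
  shows "indep2 sY (f x) (f y)"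
proof (rule Y.indep2I)
  show "f x \<noteq> 0"
    using X.indep2_not_multiple(1)[OF assms] by (simp add: f_eq_0_iff)
  fix c show "f y \<noteq> sY c (f x)"
  proof
    assume "f y = sY c (f x)"
    then have "f y = sY c (f x) + sY 0 (f x)" by simp
    then obtain a b where "y = sX a x + sX b x"
      using in_span_if_f_in_span by blast
    then have "y = sX (a + b) x"
      by (simp add: X.scale_left_distrib)
    with X.indep2_not_multiple(2)[OF assms] show False by blast
  qed
qed

lemma f_indep3:
  assumes "indep3 sX x y z"
  shows "indep3 sY (f x) (f y) (f z)"
proof (rule Y.indep3I)
  have "indep2 sX x y"
    unfolding indep2_def
  proof (intro allI impI)
    fix a b assume "sX a x + sX b y = 0"
    then have "sX a x + sX b y + sX 0 z = 0" by simp
    with assms show "a = 0 \<and> b = 0" unfolding indep3_def by blast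
  qed
  then show "indep2 sY (f x) (f y)" by (rule f_indep2)
  fix a b show "f z \<noteq> sY a (f x) + sY b (f y)"
  proof
    assume "f z = sY a (f x) + sY b (f y)"
    then obtain a b where "z = sX a x + sX b y"
      using in_span_if_f_in_span by blast
    then have "sX a x + sX b y + sX 0 z = sX 0 x + sX 0 y + sX 1 z"
      by simp
    from X.indep3D(3)[OF assms this] show False by simp
  qed
qed

text \<open>A vector \<open>w\<close> that annihilates \<open>y - \<omega> x\<close> but not
  \<open>x\<close> has the prescribed ratio. Pairing with \<open>f w\<close> turns statements about
  coefficients into equations between moduli of scalars.\<close>

lemma separate:
  assumes "indep2 sX x y"
  shows "\<exists>w. s x w \<noteq> 0 \<and> s y w = \<omega> * s x w"
proof -
  have "x \<noteq> sX a (y - sX \<omega> x) + sX b (y - sX \<omega> x)" for a b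
  proof
    assume "x = sX a (y - sX \<omega> x) + sX b (y - sX \<omega> x)"
    then have eq: "sX 1 x + sX 0 y = sX (- (a + b) * \<omega>) x + sX (a + b) y"
      by (simp add: X.scale_right_diff_distrib X.scale_left_distrib algebra_simps)
    from X.indep2D(2)[OF assms eq] X.indep2D(1)[OF assms eq] show False by simp
  qed
  then obtain w where w: "s (y - sX \<omega> x) w = 0" "s x w \<noteq> 0"
    using sep_X unfolding separating_def by blast
  have "s y w = s (y - sX \<omega> x) w + s (sX \<omega> x) w"
    by (simp flip: s_add)
  with w show ?thesis
    by (auto simp: s_scale)
qed

lemma separate_right:
  assumes "indep2 sX x y"
  shows "\<exists>w. s x w = 0 \<and> s y w \<noteq> 0"
proof -
  have "y \<noteq> sX a x + sX b x" for a b
    using X.indep2_not_multiple(2)[OF assms, of "a + b"] by (simp add: X.scale_left_distrib)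
  then show ?thesis
    using sep_X unfolding separating_def by blast
qed

lemma indep2_commute: "indep2 sX x y \<Longrightarrow> indep2 sX y x"
  unfolding indep2_def by (metis add.commute)

text \<open>Pairing with \<open>f w\<close>, where \<open>s \<cdot> w\<close> kills \<open>x\<close>
  but not \<open>y\<close>, isolates the second coefficient.\<close>

lemma norm_coeff_right:
  assumes "indep2 sX x y" "f (sX a x + sX b y) = sY \<alpha> (f x) + sY \<beta> (f y)"
  shows "norm \<beta> = norm b"
proof -
  obtain w where w: "s x w = 0" "s y w \<noteq> 0"
    using separate_right[OF assms(1)] by blast
  have "t (f x) (f w) = 0"
    using w by (simp add: modulus_0)
  then have "norm (\<beta> * t (f y) (f w)) = norm (t (f (sX a x + sX b y)) (f w))"
    by (simp add: assms(2) t_add t_scale)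
  also have "\<dots> = norm (b * s y w)"
    using w by (simp add: modulus s_add s_scale)
  finally show ?thesis
    using w by (simp add: norm_mult modulus)
qed

lemma norm_coeff_left:
  assumes "indep2 sX x y" "f (sX a x + sX b y) = sY \<alpha> (f x) + sY \<beta> (f y)"
  shows "norm \<alpha> = norm a"
  using norm_coeff_right[OF indep2_commute[OF assms(1)], of b a \<beta> \<alpha>] assms(2)
  by (simp add: add.commute)

section \<open>Equality up to a phase, and the form of the map on a plane\<close>

definition sim :: "'b \<Rightarrow> 'b \<Rightarrow> bool" where
  "sim u v \<longleftrightarrow> (\<exists>c. norm c = 1 \<and> u = sY c v)"

lemma simI: "norm c = 1 \<Longrightarrow> u = sY c v \<Longrightarrow> sim u v"
  by (auto simp: sim_def)

lemma sim_refl: "sim u u"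
  by (rule simI[of 1]) auto

lemma sim_trans [trans]: "sim u v \<Longrightarrow> sim v w \<Longrightarrow> sim u w"
  unfolding sim_def by (metis Y.scale_scale mult_1 norm_mult)

lemma sim_sym: "sim u v \<Longrightarrow> sim v u"
proof -
  assume "sim u v"
  then obtain c where c: "norm c = 1" "u = sY c v"
    by (auto simp: sim_def)
  then have "c \<noteq> 0" by auto
  with c show "sim v u"
    by (intro simI[of "inverse c"]) (auto simp: norm_inverse)
qed

lemma sim_scale: "sim u v \<Longrightarrow> sim (sY a u) (sY a v)"
  unfolding sim_def by (auto simp: mult.commute)

lemma sim_scale_norm:
  assumes "norm a = norm b"
  shows "sim (sY a u) (sY b u)"
proof (cases "b = 0")
  case True
  then show ?thesis using assms by (simp add: sim_refl)
next
  case False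
  then show ?thesis
    using assms by (intro simI[of "a / b"]) (auto simp: norm_divide)
qed

text \<open>The degenerate plane spanned by \<open>x\<close> and \<open>x\<close> shows that the
  image stays on the line of \<open>f x\<close>; preservation of the norm gives the modulus of the
  factor.\<close>

lemma sim_f_scale:
  "sim (f (sX a x)) (sY a (f x))"
proof (cases "x = 0")
  case True
  then show ?thesis
    using f_eq_0_iff[of 0] by (simp add: sim_refl)
next
  case False
  obtain \<alpha> \<beta> where "f (sX a x + sX 0 x) = sY \<alpha> (f x) + sY \<beta> (f x)"
    using f_in_span by blast
  then have eq: "f (sX a x) = sY (\<alpha> + \<beta>) (f x)"
    by (simp add: Y.scale_left_distrib)
  from arg_cong[OF this, of norm] have "norm (\<alpha> + \<beta>) = norm a"
    using False by (simp add: norm_f X.norm_smul Y.norm_smul)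
  with eq show ?thesis
    by (simp add: sim_scale_norm)
qed

theorem f_on_plane:
  assumes ind: "indep2 sX x y"
  shows "\<exists>\<theta> J. norm \<theta> = 1 \<and> id_or_conj J \<and>
    (\<forall>a b. sim (f (sX a x + sX b y)) (sY (J a) (f x) + sY (J b) (sY \<theta> (f y))))"
proof -
  have "\<exists>\<beta>. norm \<beta> = norm b \<and> sim (f (x + sX b y)) (f x + sY \<beta> (f y))" for b
  proof -
    obtain \<alpha> \<beta> where ab: "f (sX 1 x + sX b y) = sY \<alpha> (f x) + sY \<beta> (f y)"
      using f_in_span by blast
    have n: "norm \<alpha> = 1" "norm \<beta> = norm b"
      using norm_coeff_left[OF ind ab] norm_coeff_right[OF ind ab] by auto
    then have "\<alpha> \<noteq> 0" by auto
    then have "f (x + sX b y) = sY \<alpha> (f x + sY (\<beta> / \<alpha>) (f y))"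
      using ab by (simp add: Y.scale_right_distrib)
    with n show ?thesis
      by (intro exI[of _ "\<beta> / \<alpha>"]) (auto simp: norm_divide intro: simI)
  qed
  then obtain \<beta> where \<beta>: "\<And>b. norm (\<beta> b) = norm b"
    "\<And>b. sim (f (x + sX b y)) (f x + sY (\<beta> b) (f y))"
    by metis
  \<comment> \<open>Here \<open>w\<close> depends on \<open>\<omega>\<close> alone, so one scalar
    \<open>\<kappa>\<close>, the ratio of the pairings of \<open>f y\<close> and \<open>f x\<close>
    with \<open>f w\<close>, serves all \<open>b\<close> at once.\<close>
  have key: "\<exists>\<kappa>. norm \<kappa> = norm \<omega> \<and> (\<forall>b. norm (1 + \<kappa> * \<beta> b) = norm (1 + \<omega> * b))" for \<omega>
  proof -
    obtain w where w: "s x w \<noteq> 0" "s y w = \<omega> * s x w"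
      using separate[OF ind] by blast
    define T where "T = t (f x) (f w)"
    define \<kappa> where "\<kappa> = t (f y) (f w) / T"
    have T: "norm T = norm (s x w)" by (simp add: T_def modulus)
    then have T0: "T \<noteq> 0" using w by auto
    have ty: "t (f y) (f w) = \<kappa> * T"
      using T0 by (simp add: \<kappa>_def)
    have "norm (1 + \<kappa> * \<beta> b) = norm (1 + \<omega> * b)" for b
    proof -
      obtain c where c: "norm c = 1" "f (x + sX b y) = sY c (f x + sY (\<beta> b) (f y))"
        using \<beta>(2)[of b] by (auto simp: sim_def)
      have "t (f (x + sX b y)) (f w) = c * (T * (1 + \<kappa> * \<beta> b))"
        by (simp add: c t_add t_scale ty T_def[symmetric] algebra_simps)
      then have "norm T * norm (1 + \<kappa> * \<beta> b) = norm (t (f (x + sX b y)) (f w))"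
        by (simp add: norm_mult c)
      also have "\<dots> = norm (s x w * (1 + \<omega> * b))"
        by (simp add: modulus s_add s_scale w algebra_simps)
      finally show ?thesis
        using T w(1) by (simp add: norm_mult)
    qed
    moreover have "norm \<kappa> = norm \<omega>"
      using w T by (simp add: \<kappa>_def norm_divide norm_mult modulus)
    ultimately show ?thesis by blast
  qed
  obtain \<kappa>1 where \<kappa>1: "norm \<kappa>1 = 1" "\<And>b. norm (1 + \<kappa>1 * \<beta> b) = norm (1 + b)"
    using key[of 1] by auto
  then have \<kappa>1_0: "\<kappa>1 \<noteq> 0" by auto
  \<comment> \<open>The case \<open>\<omega> = 1\<close> normalises \<open>\<beta>\<close> so that
    \<open>\<gamma> b\<close> agrees with \<open>b\<close> both in modulus and in the modulus after
    adding one; hence it is \<open>b\<close> or its conjugate, a choice still depending on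
    \<open>b\<close>.\<close>
  define \<gamma> where "\<gamma> b = \<kappa>1 * \<beta> b" for b
  have "\<gamma> b = b \<or> \<gamma> b = conjugate b" for b
    using \<kappa>1 \<beta>(1) by (intro eq_or_conjugate) (auto simp: \<gamma>_def norm_mult)
  \<comment> \<open>The remaining ratios \<open>\<omega>\<close> couple the choices for different
    \<open>b\<close>.\<close>
  moreover have "\<exists>\<kappa>. \<forall>b. \<kappa> * \<gamma> b = \<omega> * b \<or> \<kappa> * \<gamma> b = conjugate (\<omega> * b)" for \<omega>
  proof -
    obtain \<kappa> where \<kappa>: "norm \<kappa> = norm \<omega>" "\<And>b. norm (1 + \<kappa> * \<beta> b) = norm (1 + \<omega> * b)"
      using key[of \<omega>] by blast
    then have "\<kappa> / \<kappa>1 * \<gamma> b = \<omega> * b \<or> \<kappa> / \<kappa>1 * \<gamma> b = conjugate (\<omega> * b)" for b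
      using \<kappa>1_0 \<beta>(1) by (intro eq_or_conjugate) (auto simp: \<gamma>_def norm_mult)
    then show ?thesis by blast
  qed
  ultimately have J: "\<gamma> = (\<lambda>b. b) \<or> \<gamma> = conjugate"
    by (rule uniform_conjugation)
  define \<theta> where "\<theta> = inverse \<kappa>1"
  have \<theta>: "norm \<theta> = 1" using \<kappa>1 by (simp add: \<theta>_def norm_inverse)
  have \<beta>_eq: "\<beta> b = \<gamma> b * \<theta>" for b
    using \<kappa>1_0 by (simp add: \<gamma>_def \<theta>_def)
  have J: "id_or_conj \<gamma>"
    using J by (simp add: id_or_conj_def)
  note J_mult = id_or_conj_simps(2)[OF J] and J_norm = id_or_conj_simps(5)[OF J]
  have "sim (f (sX a x + sX b y)) (sY (\<gamma> a) (f x) + sY (\<gamma> b) (sY \<theta> (f y)))" for a b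
  proof (cases "a = 0")
    case True
    have "sim (sY b (f y)) (sY (\<gamma> b * \<theta>) (f y))"
      using \<theta> J_norm by (intro sim_scale_norm) (simp add: norm_mult)
    with sim_f_scale have "sim (f (sX b y)) (sY (\<gamma> b * \<theta>) (f y))"
      by (rule sim_trans)
    then show ?thesis
      using True J_norm[of 0] by simp
  next
    case False
    \<comment> \<open>The factor \<open>a\<close> is taken out to reach the normalised case, and may
      be replaced by \<open>\<gamma> a\<close> up to a phase because the moduli agree.\<close>
    have "sX a x + sX b y = sX a (x + sX (b / a) y)"
      using False by (simp add: X.scale_right_distrib)
    also have "sim (f \<dots>) (sY a (f (x + sX (b / a) y)))"
      by (rule sim_f_scale)
    also have "sim \<dots> (sY a (f x + sY (\<beta> (b / a)) (f y)))"
      by (intro sim_scale \<beta>(2))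
    also have "sim \<dots> (sY (\<gamma> a) (f x + sY (\<beta> (b / a)) (f y)))"
      using J_norm by (intro sim_scale_norm) simp
    also have "\<dots> = sY (\<gamma> a) (f x) + sY (\<gamma> a * \<gamma> (b / a)) (sY \<theta> (f y))"
      by (simp add: Y.scale_right_distrib \<beta>_eq mult.assoc)
    also have "\<gamma> a * \<gamma> (b / a) = \<gamma> b"
      using False by (simp flip: J_mult)
    finally show ?thesis .
  qed
  with \<theta> J show ?thesis by blast
qed

section \<open>Gluing the planes through a fixed unit vector\<close>

context
  fixes e :: 'a
  assumes norm_e: "norm e = 1"
begin

lemma s_e_e: "s e e \<noteq> 0"
  using s_self[of e] norm_e by auto

lemma s_zero: "s 0 w = 0"
  using s_scale[of 0 0 w] by simp

lemma indep3_e: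
  assumes "indep2 sX h k" "s h e = 0" "s k e = 0"
  shows "indep3 sX e h k"
  unfolding indep3_def
proof (intro allI impI)
  fix a b c assume eq: "sX a e + sX b h + sX c k = 0"
  have "s (sX a e + sX b h + sX c k) e = a * s e e"
    by (simp add: s_add s_scale assms)
  then have "a = 0"
    unfolding eq using s_e_e by (simp add: s_zero)
  with eq assms(1) show "a = 0 \<and> b = 0 \<and> c = 0"
    by (simp add: indep2_def)
qed

lemma indep2_e:
  assumes "h \<noteq> 0" "s h e = 0"
  shows "indep2 sX e h"
proof (rule X.indep2I)
  show "e \<noteq> 0" using norm_e by auto
  fix c show "h \<noteq> sX c e"
  proof
    assume h: "h = sX c e"
    then have "c * s e e = 0"
      using assms(2) by (simp add: s_scale)
    with h assms(1) s_e_e show False by simp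
  qed
qed

text \<open>The second relation puts \<open>v\<close> on the line of \<open>f h\<close>; the
  coefficient 1 of \<open>f e\<close> in the first one removes the remaining freedom of phase, so
  that \<open>v\<close> can serve as the value at \<open>h\<close> of an additive map.\<close>

definition lifts :: "'a \<Rightarrow> 'b \<Rightarrow> bool" where
  "lifts h v \<longleftrightarrow> sim (f (e + h)) (f e + v) \<and> sim (f h) v"

text \<open>The conclusion of \<open>f_on_plane\<close> for the plane of \<open>e\<close> and
  \<open>h\<close>, with the unimodular factor absorbed into \<open>v\<close>.\<close>

definition semilifts :: "('k \<Rightarrow> 'k) \<Rightarrow> 'a \<Rightarrow> 'b \<Rightarrow> bool" where
  "semilifts J h v \<longleftrightarrow> (\<forall>a b. sim (f (sX a e + sX b h)) (sY (J a) (f e) + sY (J b) v))"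

lemma semilifts_zero:
  assumes "id_or_conj J"
  shows "semilifts J 0 0"
  unfolding semilifts_def
proof (intro allI)
  fix a b
  have "sim (f (sX a e)) (sY (J a) (f e))"
    by (rule sim_trans[OF sim_f_scale sim_scale_norm]) (simp add: id_or_conj_simps[OF assms])
  then show "sim (f (sX a e + sX b 0)) (sY (J a) (f e) + sY (J b) 0)"
    by simp
qed

lemma semilifts_exists:
  assumes "s h e = 0"
  shows "\<exists>J v. id_or_conj J \<and> semilifts J h v"
proof (cases "h = 0")
  case True
  then show ?thesis
    using semilifts_zero[of "\<lambda>b. b"] by (auto simp: id_or_conj_def)
next
  case False
  then show ?thesis
    using f_on_plane[OF indep2_e[OF False assms]] unfolding semilifts_def by blast
qed

text \<open>Combined with \<open>lifts_unique\<close>, this makes the lift of a multiple of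
  \<open>h\<close> the corresponding multiple, via \<open>J\<close>, of the lift of
  \<open>h\<close>.\<close>

lemma lifts_if_semilifts:
  assumes "id_or_conj J" "semilifts J h v"
  shows "lifts (sX c h) (sY (J c) v)"
  using assms(2)[unfolded semilifts_def, rule_format, of 1 c]
    assms(2)[unfolded semilifts_def, rule_format, of 0 c]
  by (simp add: lifts_def id_or_conj_simps[OF assms(1)])

lemma simE:
  assumes "sim u v"
  obtains c where "c \<noteq> 0" "u = sY c v"
proof -
  obtain c where "norm c = 1" "u = sY c v"
    using assms by (auto simp: sim_def)
  then show thesis by (intro that[of c]) auto
qed

lemma sim_zero: "sim 0 v \<Longrightarrow> v = 0"
  by (erule simE) simp

text \<open>Both candidates are multiples of \<open>f h\<close>. As \<open>f e + v\<close> and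
  \<open>f e + w\<close> are proportional and \<open>f e\<close>, \<open>v\<close> are independent,
  the coefficient of \<open>f e\<close> forces the factor 1, and then the coefficients of
  \<open>v\<close> agree.\<close>

lemma lifts_unique:
  assumes "s h e = 0" "lifts h v" "lifts h w"
  shows "v = w"
proof (cases "h = 0")
  case True
  then have "f h = 0" by (simp add: f_eq_0_iff)
  with assms have "sim 0 v" "sim 0 w" by (auto simp: lifts_def)
  then have "v = 0" "w = 0" by (auto intro: sim_zero)
  then show ?thesis by simp
next
  case False
  obtain c where c: "c \<noteq> 0" "f h = sY c v"
    using assms(2) unfolding lifts_def by (blast elim: simE)
  have "sim w (f h)"
    using assms(3) by (auto simp: lifts_def intro: sim_sym)
  then obtain d where "w = sY d (f h)" by (blast elim: simE)
  then have w: "w = sY (d * c) v" using c by simp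
  have "sim (f e + v) (f e + w)"
    using assms unfolding lifts_def by (blast intro: sim_sym sim_trans)
  then obtain a where "f e + v = sY a (f e + w)" by (blast elim: simE)
  then have eq: "sY 1 (f e) + sY 1 v = sY a (f e) + sY (a * d * c) v"
    by (simp add: w Y.scale_right_distrib mult.assoc)
  have "v = sY (inverse c) (f h)" using c by simp
  then have ind: "indep2 sY (f e) v"
    using Y.indep2_scale[OF f_indep2[OF indep2_e[OF False assms(1)]], of 1 "inverse c"] c by simp
  show ?thesis
    using Y.indep2D[OF ind eq] by (simp add: w)
qed

text \<open>Expanding \<open>f (e + h + k)\<close> along three planes determines all coefficients.\<close>

lemma lifts_add:
  assumes ind: "indep3 sX e h k" and "lifts h v" "lifts k w" "lifts (h + k) u"
  shows "u = v + w"
proof -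
  obtain c1 c2 c3 where c: "f (e + h) = sY c1 (f e + v)" "f (e + k) = sY c2 (f e + w)"
      "c3 \<noteq> 0" "f (e + (h + k)) = sY c3 (f e + u)"
    using assms(2-4) unfolding lifts_def by (meson simE)
  obtain d1 d2 d3 where d: "d1 \<noteq> 0" "f h = sY d1 v" "d2 \<noteq> 0" "f k = sY d2 w"
      "d3 \<noteq> 0" "f (h + k) = sY d3 u"
    using assms(2-4) unfolding lifts_def by (meson simE)
  have vw: "v = sY (inverse d1) (f h)" "w = sY (inverse d2) (f k)" "u = sY (inverse d3) (f (h + k))"
    using d by simp_all
  have ind': "indep3 sY (f e) v w"
    unfolding vw using d by (intro Y.indep3_scale f_indep3 ind) auto
  obtain \<alpha>1 \<beta>1 where 1: "f (sX 1 (e + h) + sX 1 k) = sY \<alpha>1 (f (e + h)) + sY \<beta>1 (f k)"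
    using f_in_span by blast
  obtain \<alpha>2 \<beta>2 where 2: "f (sX 1 (e + k) + sX 1 h) = sY \<alpha>2 (f (e + k)) + sY \<beta>2 (f h)"
    using f_in_span by blast
  obtain \<alpha>3 \<beta>3 where 3: "f (sX 1 h + sX 1 k) = sY \<alpha>3 (f h) + sY \<beta>3 (f k)"
    using f_in_span by blast
  define p q where "p = inverse d3 * (\<alpha>3 * d1)" and "q = inverse d3 * (\<beta>3 * d2)"
  have u: "u = sY p v + sY q w"
    using 3 vw(3) by (simp add: d(2,4) p_def q_def Y.scale_right_distrib)
  let ?F = "f (e + (h + k))"
  have F1: "?F = sY (\<alpha>1 * c1) (f e) + sY (\<alpha>1 * c1) v + sY (\<beta>1 * d2) w"
    using 1 by (simp add: c(1) d(4) Y.scale_right_distrib add.assoc)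
  have F2: "?F = sY (\<alpha>2 * c2) (f e) + sY (\<beta>2 * d1) v + sY (\<alpha>2 * c2) w"
    using 2 by (simp add: c(2) d(2) Y.scale_right_distrib ac_simps)
  have F3: "?F = sY c3 (f e) + sY (c3 * p) v + sY (c3 * q) w"
    by (simp add: c(4) u Y.scale_right_distrib add.assoc)
  \<comment> \<open>In \<open>F1\<close> the coefficients of \<open>f e\<close> and \<open>v\<close>
    coincide, in \<open>F3\<close> they are \<open>c3\<close> and \<open>c3 * p\<close>. The same
    comparison of \<open>f e\<close> and \<open>w\<close> in \<open>F2\<close> gives
    \<open>q = 1\<close>.\<close>
  have "p = 1"
    using Y.indep3D(1,2)[OF ind' F1[unfolded F3]] c(3) by auto
  moreover have "q = 1"
    using Y.indep3D(1,3)[OF ind' F2[unfolded F3]] c(3) by auto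
  ultimately show ?thesis
    by (simp add: u)
qed

text \<open>If \<open>k = c h\<close>, then \<open>J (d * c) v\<close> and \<open>K d w\<close> both
  lift \<open>d k\<close>, hence agree. If \<open>h\<close> and \<open>k\<close> are independent,
  the plane of \<open>e\<close> and \<open>h + k\<close> has its own \<open>L\<close>, and
  additivity of lifts gives \<open>L c (v + w) = J c v + K c w\<close>; comparing coefficients, both
  \<open>J\<close> and \<open>K\<close> equal \<open>L\<close>.\<close>

lemma semilifts_same:
  assumes h: "s h e = 0" "h \<noteq> 0" "id_or_conj J" "semilifts J h v"
    and k: "s k e = 0" "k \<noteq> 0" "id_or_conj K" "semilifts K k w"
  shows "J = K"
proof (cases "\<exists>c. k = sX c h")
  case True
  then obtain c where c: "k = sX c h" by blast
  have dk: "s (sX d k) e = 0" for d using k by (simp add: s_scale)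
  have eq: "sY (J (d * c)) v = sY (K d) w" for d
    using lifts_if_semilifts[OF h(3,4), of "d * c"] lifts_if_semilifts[OF k(3,4), of d]
    by (intro lifts_unique[OF dk[of d]]) (auto simp: c)
  have w: "w = sY (J c) v"
    using eq[of 1] by (simp add: id_or_conj_simps[OF k(3)])
  have "sim (f k) w"
    using lifts_if_semilifts[OF k(3,4), of 1] by (simp add: lifts_def id_or_conj_simps[OF k(3)])
  then have w0: "w \<noteq> 0"
    using k(2) by (metis Y.scale_zero_right f_eq_0_iff simE)
  show ?thesis
  proof
    fix d
    have "sY (J d) w = sY (K d) w"
      using eq[of d] by (simp add: w id_or_conj_simps[OF h(3)])
    then show "J d = K d" using w0 by simp
  qed
next
  case False
  have ind: "indep2 sX h k"
    using False h(2) by (intro X.indep2I) auto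
  obtain L u where L: "id_or_conj L" "semilifts L (h + k) u"
    using semilifts_exists[of "h + k"] h k by (auto simp: s_add)
  have eq: "sY (L c) u = sY (J c) v + sY (K c) w" for c
  proof (cases "c = 0")
    case True
    then show ?thesis using L h k by (simp add: id_or_conj_simps)
  next
    case False
    have "indep3 sX e (sX c h) (sX c k)"
      using False by (intro X.indep3_scale indep3_e ind h k)
    then show ?thesis
      using lifts_if_semilifts[OF h(3,4), of c] lifts_if_semilifts[OF k(3,4), of c]
        lifts_if_semilifts[OF L, of c]
      by (intro lifts_add) (auto simp: X.scale_right_distrib)
  qed
  have u: "u = v + w"
    using eq[of 1] by (simp add: id_or_conj_simps L h k)
  have "sim (f h) v" "sim (f k) w"
    using lifts_if_semilifts[OF h(3,4), of 1] lifts_if_semilifts[OF k(3,4), of 1]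
    by (simp_all add: lifts_def id_or_conj_simps h k)
  then obtain c d where cd: "c \<noteq> 0" "v = sY c (f h)" "d \<noteq> 0" "w = sY d (f k)"
    by (meson sim_sym simE)
  have ind': "indep2 sY v w"
    unfolding cd using cd by (intro Y.indep2_scale f_indep2 ind)
  show ?thesis
  proof
    fix c
    have "sY (L c) v + sY (L c) w = sY (J c) v + sY (K c) w"
      using eq[of c] by (simp add: u Y.scale_right_distrib)
    from Y.indep2D[OF ind' this] show "J c = K c" by simp
  qed
qed

lemma semilifts_uniform:
  "\<exists>J. id_or_conj J \<and> (\<forall>h. s h e = 0 \<longrightarrow> (\<exists>v. semilifts J h v))"
proof (cases "\<exists>h. s h e = 0 \<and> h \<noteq> 0")
  case False
  then show ?thesis
    using semilifts_zero[of "\<lambda>b. b"] by (metis id_or_conj_def)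
next
  case True
  then obtain h where h: "s h e = 0" "h \<noteq> 0" by blast
  then obtain J v where J: "id_or_conj J" "semilifts J h v"
    using semilifts_exists by blast
  have "\<exists>w. semilifts J k w" if "s k e = 0" for k
  proof (cases "k = 0")
    case True
    then show ?thesis using semilifts_zero J by blast
  next
    case False
    then show ?thesis
      using semilifts_exists[OF that] semilifts_same[OF h J that False] by blast
  qed
  with J show ?thesis by blast
qed

theorem phase_of_semilinear:
  "\<exists>U J. id_or_conj J \<and> (\<forall>x y. U (x + y) = U x + U y) \<and> (\<forall>c x. U (sX c x) = sY (J c) (U x)) \<and>
    surj U \<and> norm_preserving U \<and> phase_equivalent sY f U"
proof -
  obtain J V where J: "id_or_conj J" and V: "\<And>h. s h e = 0 \<Longrightarrow> semilifts J h (V h)"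
    using semilifts_uniform by metis
  note J_simps = id_or_conj_simps[OF J]
  have lifts: "lifts h (V h)" if "s h e = 0" for h
    using lifts_if_semilifts[OF J V[OF that], of 1] by (simp add: J_simps)
  have V_scale: "V (sX c h) = sY (J c) (V h)" if "s h e = 0" for c h
    using that by (intro lifts_unique[of "sX c h"] lifts lifts_if_semilifts J V) (simp_all add: s_scale)
  \<comment> \<open>Additivity on dependent vectors is not covered by \<open>lifts_add\<close> and
    follows from \<open>V_scale\<close>.\<close>
  have V_add: "V (h + k) = V h + V k" if h: "s h e = 0" and k: "s k e = 0" for h k
  proof (cases "indep2 sX h k")
    case True
    then show ?thesis
      using h k by (intro lifts_add[of h k] indep3_e lifts) (simp_all add: s_add)
  next
    case False
    then consider "h = 0" | c where "k = sX c h"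
      using X.indep2I by blast
    then show ?thesis
    proof cases
      case 1
      then show ?thesis
        using V_scale[OF h, of 0] by (simp add: J_simps)
    next
      case 2
      then have "V (h + k) = V (sX (1 + c) h)"
        by (simp add: X.scale_left_distrib)
      also have "\<dots> = V h + V k"
        unfolding V_scale[OF h] 2 by (simp add: J_simps Y.scale_left_distrib)
      finally show ?thesis .
    qed
  qed
  \<comment> \<open>The decomposition of \<open>x\<close> into a multiple of \<open>e\<close> and a
    vector in the kernel of \<open>s \<cdot> e\<close>, both parts linear in
    \<open>x\<close>.\<close>
  define \<pi> where "\<pi> x = s x e / s e e" for x
  define \<rho> where "\<rho> x = x - sX (\<pi> x) e" for x
  have \<pi>: "\<pi> (x + y) = \<pi> x + \<pi> y" "\<pi> (sX c x) = c * \<pi> x" for x y c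
    by (simp_all add: \<pi>_def s_add s_scale add_divide_distrib)
  have \<rho>: "\<rho> (x + y) = \<rho> x + \<rho> y" "\<rho> (sX c x) = sX c (\<rho> x)" for x y c
    by (simp_all add: \<rho>_def \<pi> X.scale_left_distrib X.scale_right_diff_distrib)
  have s\<rho>: "s (\<rho> x) e = 0" for x
  proof -
    have "s (\<rho> x) e + s (sX (\<pi> x) e) e = s x e"
      by (simp add: \<rho>_def flip: s_add)
    then show ?thesis
      using s_e_e by (simp add: s_scale \<pi>_def)
  qed
  define U where "U x = sY (J (\<pi> x)) (f e) + V (\<rho> x)" for x
  have add: "U (x + y) = U x + U y" for x y
    by (simp add: U_def \<pi> \<rho> V_add[OF s\<rho> s\<rho>] J_simps Y.scale_left_distrib)
  have scale: "U (sX c x) = sY (J c) (U x)" for x c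
    by (simp add: U_def \<pi> \<rho> V_scale[OF s\<rho>] J_simps Y.scale_right_distrib)
  have "sim (f x) (U x)" for x
    using V[OF s\<rho>[of x]] unfolding semilifts_def
    by (elim allE[of _ "\<pi> x"] allE[of _ 1]) (simp add: U_def J_simps \<rho>_def)
  then obtain \<sigma> where \<sigma>: "\<And>x. norm (\<sigma> x) = 1" "\<And>x. f x = sY (\<sigma> x) (U x)"
    unfolding sim_def by metis
  have "surj U"
    unfolding surj_def
  proof
    fix v
    obtain x where "v = f x"
      using surj by (metis surjD)
    \<comment> \<open>The phase is moved inside \<open>U\<close>; as \<open>J\<close> is an
      involution, \<open>J (\<sigma> x)\<close> becomes \<open>\<sigma> x\<close> outside.\<close>
    then have "v = U (sX (J (\<sigma> x)) x)"
      using \<sigma>(2)[of x] by (simp add: scale J_simps)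
    then show "\<exists>x. v = U x" by blast
  qed
  moreover have "norm (U x) = norm x" for x
    using norm_f[of x] unfolding \<sigma>(2)[of x] Y.norm_smul \<sigma>(1) by simp
  ultimately show ?thesis
    using J add scale \<sigma> unfolding norm_preserving_def phase_equivalent_def by blast
qed

end

end

section \<open>The theorem over both scalar fields\<close>

lemma dim_at_least_2_unit:
  fixes smul :: "'k::real_normed_field \<Rightarrow> 'a::real_normed_vector \<Rightarrow> 'a"
  assumes "normed_space_over smul" and "dim_at_least 2 smul"
  shows "\<exists>e::'a. norm e = 1"
proof -
  interpret normed_space_over smul by fact
  obtain B where B: "\<not> module.dependent smul B" "infinite B \<or> 2 \<le> card B"
    using assms(2) unfolding dim_at_least_def by blast
  have "0 \<notin> B"
    using B(1) module.dependent_zero[OF module_axioms] by blast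
  moreover have "B \<noteq> {}"
    using B(2) by auto
  ultimately obtain x :: 'a where "x \<noteq> 0"
    by (metis all_not_in_conv)
  then have "norm ((1 / norm x) *\<^sub>R x) = 1"
    by simp
  then show ?thesis by blast
qed

text \<open>The common form of both parts, with the semilinearity expressed by \<open>J\<close>.
  Compactness of balls of scalars and \<open>hahn_banach_over\<close> provide the separation that
  \<open>sip_modulus_map\<close> requires.\<close>

lemma wigner_over:
  fixes scaleX :: "'k::{real_normed_field,conjugatable_field,heine_borel} \<Rightarrow> 'a::real_normed_vector \<Rightarrow> 'a"
    and scaleY :: "'k \<Rightarrow> 'b::real_normed_vector \<Rightarrow> 'b"
  assumes X: "smooth_normed_space scaleX" "hahn_banach_over scaleX" "semi_inner_product scaleX s"
    and Y: "smooth_normed_space scaleY" "hahn_banach_over scaleY" "semi_inner_product scaleY t"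
    and conj: "\<And>c::'k. c * conjugate c = of_real ((norm c)\<^sup>2)"
    and f: "surj f" "\<And>x y. norm (t (f x) (f y)) = norm (s x y)"
    and dim: "dim_at_least 2 scaleX"
  shows "\<exists>U J. (J = (\<lambda>b. b) \<or> J = conjugate) \<and> (\<forall>x y. U (x + y) = U x + U y) \<and>
    (\<forall>c x. U (scaleX c x) = scaleY (J c) (U x)) \<and>
    surj U \<and> norm_preserving U \<and> phase_equivalent scaleY f U"
proof -
  interpret X: smooth_normed_space scaleX by (rule X)
  interpret Y: smooth_normed_space scaleY by (rule Y)
  interpret sip_modulus_map scaleX scaleY s t f
    using assms separating_sip[OF X(1) conj X(2,3)] separating_sip[OF Y(1) conj Y(2,3)]
    by unfold_locales auto
  obtain e :: 'a where "norm e = 1"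
    using dim_at_least_2_unit[OF X.normed_space_over_axioms dim] by blast
  from phase_of_semilinear[OF this] show ?thesis
    unfolding id_or_conj_def .
qed

theorem theorem2p2:
  fixes f :: "'a::real_normed_vector \<Rightarrow> 'b::real_normed_vector"
    and g :: "'c::real_normed_vector \<Rightarrow> 'd::real_normed_vector"
    and scaleX :: "complex \<Rightarrow> 'c \<Rightarrow> 'c"
    and scaleY :: "complex \<Rightarrow> 'd \<Rightarrow> 'd"
  shows
    "(smooth_normed_space (scaleR :: real \<Rightarrow> 'a \<Rightarrow> 'a) \<and>
      smooth_normed_space (scaleR :: real \<Rightarrow> 'b \<Rightarrow> 'b) \<and>
      surj f \<and>
      (\<forall>x y. \<bar>sip scaleR (f x) (f y)\<bar> = \<bar>sip scaleR x y\<bar>) \<and>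
      dim_at_least 2 (scaleR :: real \<Rightarrow> 'a \<Rightarrow> 'a)
      \<longrightarrow> (\<exists>U. linear U \<and> surj U \<and> norm_preserving U \<and> phase_equivalent scaleR f U))
    \<and>
     (smooth_normed_space scaleX \<and>
      smooth_normed_space scaleY \<and>
      surj g \<and>
      (\<forall>x y. cmod (sip scaleY (g x) (g y)) = cmod (sip scaleX x y)) \<and>
      dim_at_least 2 scaleX
      \<longrightarrow> (\<exists>U. (Vector_Spaces.linear scaleX scaleY U \<or> conjugate_linear scaleX scaleY U) \<and>
              surj U \<and> norm_preserving U \<and> phase_equivalent scaleY g U))"
proof (intro conjI impI; elim conjE)
  assume X: "smooth_normed_space (scaleR :: real \<Rightarrow> 'a \<Rightarrow> 'a)"
    and Y: "smooth_normed_space (scaleR :: real \<Rightarrow> 'b \<Rightarrow> 'b)"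
    and f: "surj f" "\<forall>x y. \<bar>sip scaleR (f x) (f y)\<bar> = \<bar>sip scaleR x y\<bar>"
    and dim: "dim_at_least 2 (scaleR :: real \<Rightarrow> 'a \<Rightarrow> 'a)"
  have sX: "semi_inner_product scaleR (sip scaleR :: 'a \<Rightarrow> 'a \<Rightarrow> real)"
    and sY: "semi_inner_product scaleR (sip scaleR :: 'b \<Rightarrow> 'b \<Rightarrow> real)"
    using sip_real(1)[OF X] sip_real(1)[OF Y] by blast+
  obtain U and J :: "real \<Rightarrow> real" where J: "J = (\<lambda>b. b) \<or> J = conjugate"
    and U: "\<And>x y. U (x + y) = U x + U y" "\<And>c x. U (c *\<^sub>R x) = J c *\<^sub>R U x"
      "surj U" "norm_preserving U" "phase_equivalent scaleR f U"
    using wigner_over[OF X hahn_banach_over_real sX Y hahn_banach_over_real sY _ f(1) _ dim] f(2)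
    by (auto simp: power2_eq_square)
  \<comment> \<open>Real conjugation is the identity, so both alternatives for \<open>J\<close> give
    linearity.\<close>
  have "linear U"
    using J U(1,2) by (intro linearI) auto
  with U show "\<exists>U. linear U \<and> surj U \<and> norm_preserving U \<and> phase_equivalent scaleR f U"
    by blast
next
  assume X: "smooth_normed_space scaleX" and Y: "smooth_normed_space scaleY"
    and g: "surj g" "\<forall>x y. cmod (sip scaleY (g x) (g y)) = cmod (sip scaleX x y)"
    and dim: "dim_at_least 2 scaleX"
  interpret X: smooth_normed_space scaleX by (rule X)
  interpret Y: smooth_normed_space scaleY by (rule Y)
  have sX: "semi_inner_product scaleX (sip scaleX)" and sY: "semi_inner_product scaleY (sip scaleY)"
    using sip_complex(1)[OF X] sip_complex(1)[OF Y] by blast+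
  note hb = hahn_banach_over_complex[OF X.normed_space_over_axioms]
    hahn_banach_over_complex[OF Y.normed_space_over_axioms]
  have conj: "c * conjugate c = of_real ((cmod c)\<^sup>2)" for c
    by (simp only: conjugate_complex_def complex_norm_square)
  obtain U and J :: "complex \<Rightarrow> complex" where J: "J = (\<lambda>b. b) \<or> J = conjugate"
    and U: "\<And>x y. U (x + y) = U x + U y" "\<And>c x. U (scaleX c x) = scaleY (J c) (U x)"
      "surj U" "norm_preserving U" "phase_equivalent scaleY g U"
    using wigner_over[OF X hb(1) sX Y hb(2) sY conj g(1) _ dim] g(2) by blast
  from J have "Vector_Spaces.linear scaleX scaleY U \<or> conjugate_linear scaleX scaleY U"
  proof
    assume "J = (\<lambda>b. b)"
    then have "Vector_Spaces.linear scaleX scaleY U"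
      using U(1,2) X.vector_space_axioms Y.vector_space_axioms
      by (auto simp: Vector_Spaces.linear_def module_hom_def module_hom_axioms_def
          module_iff_vector_space)
    then show ?thesis ..
  next
    assume "J = conjugate"
    then have "conjugate_linear scaleX scaleY U"
      using U(1,2) by (simp add: conjugate_linear_def)
    then show ?thesis ..
  qed
  with U show "\<exists>U. (Vector_Spaces.linear scaleX scaleY U \<or> conjugate_linear scaleX scaleY U) \<and>
      surj U \<and> norm_preserving U \<and> phase_equivalent scaleY g U"
    by blast
qed

end
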